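(* Let $\mathcal{G}$ and $\mathcal{G}'$ be connected metric graphs with (disjoint) vertex sets $\mathsf{V}$ and $\mathsf{V}'$, respectively. Let $\alpha\in[0,\infty)^{\mathsf{V}}$ and $\alpha'\in[0,\infty)^{\mathsf{V}'}$ be not identically zero. Let $\mathsf{v}_0\in\mathsf{V}$ and let $\tilde{\mathcal{G}}$ be a metric graph formed by inserting $\mathcal{G}'$ into $\mathcal{G}$ at $\mathsf{v}_0$. Let $\tilde\alpha\in[0,\infty)^{(\mathsf{V}\cup\mathsf{V}')\setminus\{\mathsf{v}_0\}}$ be defined by $\tilde\alpha_{\mathsf{v}}=\alpha_{\mathsf{v}}$ for $\mathsf{v}\in\mathsf{V}\setminus\{\mathsf{v}_0\}$ and $\tilde\alpha_{\mathsf{v}}=\alpha'_{\mathsf{v}}$ for $\mathsf{v}\in\mathsf{V}'$. If $$\sum_{\mathsf{v}'\in\mathsf{V}'}\alpha'_{\mathsf{v}'}\leq\alpha_{\mathsf{v}_0},$$ then $T(\mathcal{G},\alpha)\leq T(\tilde{\mathcal{G}},\tilde\alpha)$.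
   Context: A metric graph $\mathcal{G}$ is a finite collection of intervals glued together at their endpoints according to a finite combinatorial graph $(\mathsf{V},\mathsf{E})$ (loops and multiple edges allowed); each edge $\mathsf{e}\in\mathsf{E}$ is identified with $[0,\ell_{\mathsf{e}}]$, $\ell_{\mathsf{e}}\in(0,\infty)$. It is connected if any two points are joined by a continuous path. $\mathsf{E}_{\mathsf{v}}$ is the collection of edges incident to $\mathsf{v}$ (a loop at $\mathsf{v}$ counted twice, once for each endpoint), $u_{\mathsf{e}}$ is the restriction of $u$ to $\mathsf{e}$, and $\frac{\partial u_{\mathsf{e}}}{\partial n}(\mathsf{v})$ is the derivative of $u_{\mathsf{e}}$ at the endpoint $\mathsf{v}$ in the direction pointing into $\mathsf{v}$. For $\alpha\in\mathbb{R}^{\mathsf{V}}$ (the strengths), the operator $-\Delta_{\mathcal{G},\alpha}$ in $L^2(\mathcal{G})$ acts as $u\mapsto -u''$ on each edge, on functions that are edgewise in $H^2(0,\ell_{\mathsf{e}})$, continuous at every vertex, and satisfy $\sum_{\mathsf{e}\in\mathsf{E}_{\mathsf{v}}}\frac{\partial u_{\mathsf{e}}}{\partial n}(\mathsf{v})+\alpha_{\mathsf{v}}u(\mathsf{v})=0$ for all $\mathsf{v}\in\mathsf{V}$. The torsion function of $(\mathcal{G},\alpha)$ is the unique solution $\upsilon$ of $-\Delta_{\mathcal{G},\alpha}\upsilon=1$ (it exists and is strictly positive when $\mathcal{G}$ is connected and $\alpha\in[0,\infty)^{\mathsf{V}}$ is not identically zero), and the torsional rigidity is $T(\mathcal{G},\alpha)=\int_{\mathcal{G}}\upsilon(x)\,\mathrm{d}x$.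 Inserting: $\tilde{\mathcal{G}}$ is obtained by inserting $\mathcal{G}'$ into $\mathcal{G}$ at $\mathsf{v}_0$ if it is formed by removing $\mathsf{v}_0$ from $\mathcal{G}$ and attaching each of the edges $\mathsf{e}\in\mathsf{E}_{\mathsf{v}_0}$ (at the end where it was attached to $\mathsf{v}_0$) to one of the vertices of $\mathcal{G}'$; all edge lengths are kept. Such $\tilde{\mathcal{G}}$ is not necessarily unique. *)

theory Defs
  imports "HOL-Analysis.Analysis"
begin

text \<open>The functions \<open>tail\<close> and \<open>head\<close> fix, for each edge \<open>e\<close>, the identification of \<open>e\<close> with
  \<open>[0, len e]\<close>: the endpoint \<open>0\<close> lies at \<open>tail e\<close>, the endpoint \<open>len e\<close> at \<open>head e\<close>. Loops and
  parallel edges are allowed; the orientation has no other meaning.\<close>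

record ('v, 'e) mgraph =
  verts :: "'v set"
  edges :: "'e set"
  tail  :: "'e \<Rightarrow> 'v"
  head  :: "'e \<Rightarrow> 'v"
  len   :: "'e \<Rightarrow> real"

definition metric_graph :: "('v, 'e) mgraph \<Rightarrow> bool" where
  "metric_graph G \<longleftrightarrow>
     finite (verts G) \<and> finite (edges G) \<and>
     (\<forall>e\<in>edges G. tail G e \<in> verts G \<and> head G e \<in> verts G \<and> 0 < len G e)"

text \<open>Points of the metric graph: its vertices and the interior points of its edges.\<close>

datatype ('v, 'e) gpoint = Vertex 'v | Interior 'e real

definition points :: "('v, 'e) mgraph \<Rightarrow> ('v, 'e) gpoint set" where
  "points G = Vertex ` verts G \<union> {Interior e x | e x. e \<in> edges G \<and> 0 < x \<and> x < len G e}"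

text \<open>The gluing map, sending \<open>x \<in> [0, len e]\<close> to the point of the graph it represents.\<close>

definition edge_point :: "('v, 'e) mgraph \<Rightarrow> 'e \<Rightarrow> real \<Rightarrow> ('v, 'e) gpoint" where
  "edge_point G e x =
     (if x = 0 then Vertex (tail G e)
      else if x = len G e then Vertex (head G e)
      else Interior e x)"

text \<open>The quotient topology of the disjoint union of the (discrete) vertex set and the intervals
  \<open>[0, len e]\<close>.\<close>

definition graph_topology :: "('v, 'e) mgraph \<Rightarrow> ('v, 'e) gpoint topology" where
  "graph_topology G = topology (\<lambda>U. U \<subseteq> points G \<and>
     (\<forall>e\<in>edges G. openin (top_of_set {0..len G e}) {x \<in> {0..len G e}. edge_point G e x \<in> U}))"

lemma openin_graph_topology:
  "openin (graph_topology G) U \<longleftrightarrow> U \<subseteq> points G \<and>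
     (\<forall>e\<in>edges G. openin (top_of_set {0..len G e}) {x \<in> {0..len G e}. edge_point G e x \<in> U})"
proof -
  let ?P = "\<lambda>e U. {x \<in> {0..len G e}. edge_point G e x \<in> U}"
  have int: "?P e (S \<inter> T) = ?P e S \<inter> ?P e T" for e S T by auto
  have un: "?P e (\<Union>K) = (\<Union>S\<in>K. ?P e S)" for e K by auto
  have "istopology (\<lambda>U. U \<subseteq> points G \<and>
     (\<forall>e\<in>edges G. openin (top_of_set {0..len G e}) (?P e U)))"
    unfolding istopology_def int un by (auto intro!: openin_Union)
  then show ?thesis
    unfolding graph_topology_def by (simp add: topology_inverse')
qed

lemma edge_point_in_points:
  "\<lbrakk>metric_graph G; e \<in> edges G; x \<in> {0..len G e}\<rbrakk> \<Longrightarrow> edge_point G e x \<in> points G"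
  by (auto simp: metric_graph_def edge_point_def points_def)

lemma topspace_graph_topology:
  assumes "metric_graph G"
  shows "topspace (graph_topology G) = points G"
proof -
  have "{x \<in> {0..len G e}. edge_point G e x \<in> points G} = {0..len G e}" if "e \<in> edges G" for e
    using edge_point_in_points[OF assms that] by auto
  then have "openin (graph_topology G) (points G)"
    by (simp add: openin_graph_topology)
  then show ?thesis
    by (metis openin_graph_topology openin_subset openin_topspace subset_antisym)
qed

definition connected_graph :: "('v, 'e) mgraph \<Rightarrow> bool" where
  "connected_graph G \<longleftrightarrow> path_connected_space (graph_topology G)"

text \<open>Sobolev spaces on the interval \<open>(0, l)\<close>. Weak derivatives are tested against \<open>C\<^sup>1\<close> functions
  with compact support in \<open>(0, l)\<close>, which gives the same weak derivatives as smooth test functions.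
  Functions are honest functions on the real line; only their values on \<open>(0, l)\<close>, up to a null set,
  matter here.\<close>

definition L2 :: "real \<Rightarrow> (real \<Rightarrow> real) set" where
  "L2 l = {f. f \<in> borel_measurable (lebesgue_on {0<..<l}) \<and>
              integrable (lebesgue_on {0<..<l}) (\<lambda>x. (f x)\<^sup>2)}"

definition test_functions :: "real \<Rightarrow> (real \<Rightarrow> real) set" where
  "test_functions l = {\<phi>. \<phi> C1_differentiable_on UNIV \<and> closure {x. \<phi> x \<noteq> 0} \<subseteq> {0<..<l}}"

definition weak_derivative :: "real \<Rightarrow> (real \<Rightarrow> real) \<Rightarrow> (real \<Rightarrow> real) \<Rightarrow> bool" where
  "weak_derivative l u w \<longleftrightarrow> (\<forall>\<phi>\<in>test_functions l.
     (LINT x|lebesgue_on {0<..<l}. u x * deriv \<phi> x) = - (LINT x|lebesgue_on {0<..<l}. w x * \<phi> x))"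

definition H1 :: "real \<Rightarrow> (real \<Rightarrow> real) set" where
  "H1 l = {u \<in> L2 l. \<exists>w\<in>L2 l. weak_derivative l u w}"

definition H2 :: "real \<Rightarrow> (real \<Rightarrow> real) set" where
  "H2 l = {u \<in> H1 l. \<exists>w\<in>H1 l. weak_derivative l u w}"

definition weak_derivative2 :: "real \<Rightarrow> (real \<Rightarrow> real) \<Rightarrow> (real \<Rightarrow> real) \<Rightarrow> bool" where
  "weak_derivative2 l u f \<longleftrightarrow> (\<exists>w\<in>L2 l. weak_derivative l u w \<and> weak_derivative l w f)"

definition restrict_edge :: "('v, 'e) mgraph \<Rightarrow> (('v, 'e) gpoint \<Rightarrow> real) \<Rightarrow> 'e \<Rightarrow> real \<Rightarrow> real" where
  "restrict_edge G u e = (\<lambda>x. u (edge_point G e x))"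

text \<open>Derivatives of \<open>u\<close> on \<open>e\<close> at its two endpoints, in the direction pointing into the endpoint
  (one-sided derivatives, hence the sign at the endpoint \<open>0\<close>).\<close>

definition normal_deriv_head :: "('v, 'e) mgraph \<Rightarrow> (('v, 'e) gpoint \<Rightarrow> real) \<Rightarrow> 'e \<Rightarrow> real" where
  "normal_deriv_head G u e =
     vector_derivative (restrict_edge G u e) (at (len G e) within {0..len G e})"

definition normal_deriv_tail :: "('v, 'e) mgraph \<Rightarrow> (('v, 'e) gpoint \<Rightarrow> real) \<Rightarrow> 'e \<Rightarrow> real" where
  "normal_deriv_tail G u e =
     - vector_derivative (restrict_edge G u e) (at 0 within {0..len G e})"

text \<open>A loop at \<open>v\<close> contributes to both sums.\<close>

definition normal_deriv_sum :: "('v, 'e) mgraph \<Rightarrow> (('v, 'e) gpoint \<Rightarrow> real) \<Rightarrow> 'v \<Rightarrow> real" where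
  "normal_deriv_sum G u v =
     (\<Sum>e \<in> {e \<in> edges G. head G e = v}. normal_deriv_head G u e) +
     (\<Sum>e \<in> {e \<in> edges G. tail G e = v}. normal_deriv_tail G u e)"

text \<open>Elements of the operator domain are given by their continuous representatives, which exist
  because edgewise \<open>H\<^sup>2\<close> functions are continuous up to the endpoints of the edges. Requiring them to
  be \<open>extensional\<close> makes the representative unique as a HOL function.\<close>

definition laplacian_domain ::
  "('v, 'e) mgraph \<Rightarrow> ('v \<Rightarrow> real) \<Rightarrow> (('v, 'e) gpoint \<Rightarrow> real) set" where
  "laplacian_domain G \<alpha> = {u \<in> extensional (points G).
     (\<forall>e\<in>edges G. restrict_edge G u e \<in> H2 (len G e)) \<and>
     continuous_map (graph_topology G) euclideanreal u \<and>
     (\<forall>v\<in>verts G. normal_deriv_sum G u v + \<alpha> v * u (Vertex v) = 0)}"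

text \<open>\<open>minus_laplacian G \<alpha> u f\<close> says that \<open>u\<close> lies in the domain and the operator maps it to (the
  class in \<open>L\<^sup>2\<close> of) \<open>f\<close>.\<close>

definition minus_laplacian ::
  "('v, 'e) mgraph \<Rightarrow> ('v \<Rightarrow> real) \<Rightarrow> (('v, 'e) gpoint \<Rightarrow> real) \<Rightarrow> (('v, 'e) gpoint \<Rightarrow> real) \<Rightarrow> bool"
  where
  "minus_laplacian G \<alpha> u f \<longleftrightarrow> u \<in> laplacian_domain G \<alpha> \<and>
     (\<forall>e\<in>edges G. restrict_edge G f e \<in> L2 (len G e) \<and>
        weak_derivative2 (len G e) (restrict_edge G u e) (\<lambda>x. - restrict_edge G f e x))"

definition torsion_function :: "('v, 'e) mgraph \<Rightarrow> ('v \<Rightarrow> real) \<Rightarrow> ('v, 'e) gpoint \<Rightarrow> real" where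
  "torsion_function G \<alpha> = (THE u. minus_laplacian G \<alpha> u (\<lambda>_. 1))"

definition graph_integral :: "('v, 'e) mgraph \<Rightarrow> (('v, 'e) gpoint \<Rightarrow> real) \<Rightarrow> real" where
  "graph_integral G f = (\<Sum>e\<in>edges G. LINT x|lebesgue_on {0..len G e}. restrict_edge G f e x)"

definition torsional_rigidity :: "('v, 'e) mgraph \<Rightarrow> ('v \<Rightarrow> real) \<Rightarrow> real" where
  "torsional_rigidity G \<alpha> = graph_integral G (torsion_function G \<alpha>)"

text \<open>\<open>H\<close> is obtained by inserting \<open>G'\<close> into \<open>G\<close> at \<open>v0\<close>. Every edge end at \<open>v0\<close> is reattached
  independently (in particular the two ends of a loop at \<open>v0\<close>) to an arbitrary vertex of \<open>G'\<close>.\<close>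

definition is_insertion ::
  "('v, 'e) mgraph \<Rightarrow> 'v \<Rightarrow> ('v, 'e) mgraph \<Rightarrow> ('v, 'e) mgraph \<Rightarrow> bool" where
  "is_insertion G v0 G' H \<longleftrightarrow>
     verts H = (verts G \<union> verts G') - {v0} \<and>
     edges H = edges G \<union> edges G' \<and>
     (\<forall>e\<in>edges G'. tail H e = tail G' e \<and> head H e = head G' e \<and> len H e = len G' e) \<and>
     (\<forall>e\<in>edges G. len H e = len G e \<and>
        (if tail G e = v0 then tail H e \<in> verts G' else tail H e = tail G e) \<and>
        (if head G e = v0 then head H e \<in> verts G' else head H e = head G e))"

end

theory Submission
  imports Defs
begin

text \<open>
  On every edge the torsion function solves \<open>- u'' = 1\<close>, so it is the quadratic polynomial determined
  by its values at the two endpoints. The vertex conditions then become a finite linear system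
  \<open>energy U W = load W\<close> (for all \<open>W\<close>) for the vector \<open>U\<close> of vertex values: the weighted graph
  Laplacian plus the diagonal matrix of strengths, which is positive definite by connectedness.
  The torsional rigidity is \<open>load U + \<Sum>\<^sub>e len\<^sub>e\<^sup>3 / 12\<close>, and \<open>load U\<close> is the maximum of
  \<open>2 load W - energy W W\<close> over all \<open>W\<close>. For the enlarged graph one tests this functional with
  \<open>\<bar>U\<bar>\<close>, extended by the constant \<open>\<bar>U v0\<bar>\<close> to the inserted graph.
\<close>

section \<open>Weak solutions on an interval\<close>

text \<open>The vanishing integral makes the primitive return to zero at \<open>c\<close>, so
  compact support survives integration. Two applications build a test function with a prescribed
  second derivative.\<close>

lemma compact_antiderivative:
  fixes \<psi> :: "real \<Rightarrow> real"
  assumes cont: "continuous_on UNIV \<psi>" and supp: "\<And>x. x \<notin> {a..c} \<Longrightarrow> \<psi> x = 0"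
    and int0: "integral {a..c} \<psi> = 0"
  obtains \<Psi> where "\<And>x. (\<Psi> has_real_derivative \<psi> x) (at x)" "\<And>x. x \<notin> {a..c} \<Longrightarrow> \<Psi> x = 0"
proof
  \<comment> \<open>The base point \<open>a-1\<close> keeps every \<open>x >= a\<close> interior to
    \<open>{a-1..x+1}\<close>, so the derivative obtained there is two-sided; for
    \<open>x < a\<close> the primitive is locally zero.\<close>
  define \<Psi> where "\<Psi> x = integral {a-1..x} \<psi>" for x
  have left: "\<Psi> x = 0" if "x < a" for x
    unfolding \<Psi>_def using that by (subst integral_cong[of _ _ "\<lambda>_. 0"]) (auto intro: supp)
  have right: "\<Psi> x = 0" if "c < x" for x
  proof -
    have "(\<psi> has_integral 0) {a..c}"
      using int0 integrable_continuous_real[of a c \<psi>] cont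
      by (metis continuous_on_subset has_integral_integral subset_UNIV)
    then have "(\<psi> has_integral 0) {a-1..x}"
      by (rule has_integral_on_superset) (use supp that in auto)
    then show ?thesis by (simp add: \<Psi>_def integral_unique)
  qed
  show "\<Psi> x = 0" if "x \<notin> {a..c}" for x
    using that left right by fastforce
  show "(\<Psi> has_real_derivative \<psi> x) (at x)" for x
  proof (cases "x < a")
    case True
    have "((\<lambda>_. 0) has_real_derivative 0) (at x)" by simp
    then have "(\<Psi> has_real_derivative 0) (at x)"
      by (rule has_field_derivative_transform_within_open[of _ _ _ "{..<a}"]) (use True left in auto)
    then show ?thesis using True supp by simp
  next
    case False
    have "((\<lambda>x. integral {a-1..x} \<psi>) has_real_derivative \<psi> x) (at x within {a-1..x+1})"
      by (rule integral_has_real_derivative)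
         (use cont False in \<open>auto intro: continuous_on_subset\<close>)
    moreover have "at x within {a-1..x+1} = at x"
      by (rule at_within_interior) (use False in auto)
    ultimately show ?thesis by (simp add: \<Psi>_def[abs_def])
  qed
qed

text \<open>Du Bois-Reymond lemma of second order: the two moment conditions are those under which
  \<psi> has a second primitive supported in \<open>{a..c}\<close>, so \<open>orth\<close> says that
  \<open>g\<close> annihilates all such second derivatives.\<close>

lemma affine_if_orthogonal:
  fixes g :: "real \<Rightarrow> real"
  assumes "a < c" and cont: "continuous_on {a..c} g"
    and orth: "\<And>\<psi>. \<lbrakk>continuous_on UNIV \<psi>; \<And>x. x \<notin> {a..c} \<Longrightarrow> \<psi> x = 0;
       integral {a..c} \<psi> = 0; integral {a..c} (\<lambda>x. x * \<psi> x) = 0\<rbrakk>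
       \<Longrightarrow> integral {a..c} (\<lambda>x. g x * \<psi> x) = 0"
  shows "\<exists>A B. \<forall>x\<in>{a<..<c}. g x = A + B * x"
proof -
  \<comment> \<open>This weight is positive inside and zero at both ends, so its product with a
    function continuous on \<open>{a..c}\<close> extends continuously by zero.\<close>
  define \<omega> where "\<omega> x = (x - a) * (c - x)" for x
  let ?I = "\<lambda>f. integral {a..c} (f :: real \<Rightarrow> real)"
  have c\<omega>: "continuous_on S \<omega>" for S unfolding \<omega>_def by (intro continuous_intros)
  have \<omega>0: "\<omega> x \<ge> 0" if "x \<in> {a..c}" for x using that by (simp add: \<omega>_def)
  have \<omega>pos: "\<omega> x > 0" if "x \<in> {a<..<c}" for x using that by (simp add: \<omega>_def)
  have int: "f integrable_on {a..c}" if "continuous_on {a..c} f" for f :: "real \<Rightarrow> real"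
    using that by (rule integrable_continuous_real)
  have zero: "f x = 0" if "?I (\<lambda>x. \<omega> x * (f x)\<^sup>2) = 0" "continuous_on {a..c} f" "x \<in> {a<..<c}"
    for f :: "real \<Rightarrow> real" and x
  proof -
    have "\<omega> x * (f x)\<^sup>2 = 0"
      using integral_eq_0_iff[of a c "\<lambda>x. \<omega> x * (f x)\<^sup>2"] that \<omega>0 \<open>a < c\<close> 
      by (force intro!: continuous_intros c\<omega>)
    then show ?thesis using \<omega>pos[OF that(3)] by simp
  qed
  \<comment> \<open>The test function is \<open>\<psi> = \<omega> h\<close>, where \<open>h\<close> is \<open>g\<close> minus its orthogonal projection onto the affine
    functions in \<open>L\<^sup>2(\<omega> dx)\<close>; the centroid \<open>m\<close> makes \<open>1\<close> and \<open>x - m\<close> an orthogonal basis.\<close>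
  define W where "W = ?I \<omega>"
  have W: "W \<noteq> 0"
    using zero[of "\<lambda>_. 1" "(a+c)/2"] \<open>a < c\<close> by (auto simp: W_def)
  define m where "m = ?I (\<lambda>x. \<omega> x * x) / W"
  define W2 where "W2 = ?I (\<lambda>x. \<omega> x * (x - m)\<^sup>2)"
  have W2: "W2 \<noteq> 0"
  proof
    assume "W2 = 0"
    then have "x - m = 0" if "x \<in> {a<..<c}" for x
      unfolding W2_def by (rule zero) (use that in \<open>auto intro!: continuous_intros\<close>)
    \<comment> \<open>Two distinct points of the interval cannot both equal
      \<open>m\<close>.\<close>
    from this[of "(a+c)/2"] this[of "(a+2*c)/3"] show False using \<open>a < c\<close> by (auto simp: field_simps)
  qed
  have W1: "?I (\<lambda>x. \<omega> x * (x - m)) = 0"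
  proof -
    have "?I (\<lambda>x. \<omega> x * (x - m)) = ?I (\<lambda>x. \<omega> x * x - \<omega> x * m)"
      by (simp add: right_diff_distrib)
    also have "\<dots> = ?I (\<lambda>x. \<omega> x * x) - W * m"
      unfolding W_def by (subst integral_diff) (auto intro!: int continuous_intros c\<omega>)
    finally show ?thesis using W by (simp add: m_def)
  qed
  define \<beta> where "\<beta> = ?I (\<lambda>x. \<omega> x * g x) / W"
  define \<gamma> where "\<gamma> = ?I (\<lambda>x. \<omega> x * (x - m) * g x) / W2"
  define h where "h x = g x - \<beta> - \<gamma> * (x - m)" for x
  have ch: "continuous_on {a..c} h" unfolding h_def by (intro continuous_intros cont)
  \<comment> \<open>Clamping the argument extends \<open>h\<close>, which is known to be continuous
    only on \<open>{a..c}\<close>; the factor \<open>max 0 (\<omega> x)\<close> vanishes outside,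
    where the weight is negative.\<close>
  define \<psi> where "\<psi> x = max 0 (\<omega> x) * h (max a (min c x))" for x
  have \<psi>: "\<psi> x = \<omega> x * h x" if "x \<in> {a..c}" for x
    using \<omega>0[OF that] that by (simp add: \<psi>_def max_def)
  have c\<psi>: "continuous_on UNIV \<psi>"
    unfolding \<psi>_def
    by (intro continuous_intros c\<omega> continuous_on_compose2[OF ch]) (use \<open>a < c\<close> in auto)
  have supp: "\<psi> x = 0" if "x \<notin> {a..c}" for x
  proof -
    have "\<omega> x \<le> 0" using that \<open>a < c\<close> by (auto simp: \<omega>_def mult_le_0_iff)
    then show ?thesis by (simp add: \<psi>_def)
  qed
  have I\<psi>: "?I (\<lambda>x. f x * \<psi> x) = ?I (\<lambda>x. f x * (\<omega> x * h x))" for f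
    by (rule integral_cong) (simp add: \<psi>)
  have M0: "?I (\<lambda>x. \<omega> x * h x) = 0"
  proof -
    have "?I (\<lambda>x. \<omega> x * h x) = ?I (\<lambda>x. \<omega> x * g x - \<omega> x * \<beta> - \<gamma> * (\<omega> x * (x - m)))"
      by (simp add: h_def algebra_simps)
    also have "\<dots> = ?I (\<lambda>x. \<omega> x * g x) - W * \<beta> - \<gamma> * ?I (\<lambda>x. \<omega> x * (x - m))"
      unfolding W_def
      by (simp add: integral_diff int continuous_intros c\<omega> cont)
    finally show ?thesis using W W1 by (simp add: \<beta>_def)
  qed
  have M1: "?I (\<lambda>x. (x - m) * (\<omega> x * h x)) = 0"
  proof -
    have "?I (\<lambda>x. (x - m) * (\<omega> x * h x)) =
      ?I (\<lambda>x. \<omega> x * (x - m) * g x - \<beta> * (\<omega> x * (x - m)) - \<gamma> * (\<omega> x * (x - m)\<^sup>2))"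
      by (simp add: h_def algebra_simps power2_eq_square)
    also have "\<dots> = ?I (\<lambda>x. \<omega> x * (x - m) * g x) - \<beta> * ?I (\<lambda>x. \<omega> x * (x - m)) - \<gamma> * W2"
      unfolding W2_def
      by (simp add: integral_diff int continuous_intros c\<omega> cont)
    finally show ?thesis using W2 W1 by (simp add: \<gamma>_def)
  qed
  have M1': "?I (\<lambda>x. x * (\<omega> x * h x)) = 0"
  proof -
    have "?I (\<lambda>x. x * (\<omega> x * h x)) = ?I (\<lambda>x. (x - m) * (\<omega> x * h x) + m * (\<omega> x * h x))"
      by (simp add: algebra_simps)
    also have "\<dots> = 0"
      by (simp add: integral_add int continuous_intros c\<omega> ch M0 M1)
    finally show ?thesis .
  qed
  have "?I (\<lambda>x. g x * \<psi> x) = 0"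
  proof (rule orth[OF c\<psi> supp])
    show "?I \<psi> = 0" using I\<psi>[of "\<lambda>_. 1"] M0 by simp
    show "?I (\<lambda>x. x * \<psi> x) = 0" using I\<psi>[of "\<lambda>x. x"] M1' by simp
  qed simp
  then have "?I (\<lambda>x. g x * (\<omega> x * h x)) = 0" by (simp add: I\<psi>)
  \<comment> \<open>One factor \<open>h\<close> is expanded: its affine part integrates to zero by
    \<open>M0\<close> and \<open>M1\<close>, its \<open>g\<close> part by orthogonality.\<close>
  moreover have "?I (\<lambda>x. \<omega> x * (h x)\<^sup>2) =
      ?I (\<lambda>x. g x * (\<omega> x * h x) - \<beta> * (\<omega> x * h x) - \<gamma> * ((x - m) * (\<omega> x * h x)))"
    by (rule integral_cong) (simp add: h_def algebra_simps power2_eq_square)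
  moreover have "\<dots> = ?I (\<lambda>x. g x * (\<omega> x * h x)) - \<beta> * ?I (\<lambda>x. \<omega> x * h x)
      - \<gamma> * ?I (\<lambda>x. (x - m) * (\<omega> x * h x))"
    by (simp add: integral_diff int continuous_intros c\<omega> ch cont)
  ultimately have "?I (\<lambda>x. \<omega> x * (h x)\<^sup>2) = 0" using M0 M1 by simp
  from zero[OF this ch] have "g x = (\<beta> - \<gamma> * m) + \<gamma> * x" if "x \<in> {a<..<c}" for x
    using that by (simp add: h_def algebra_simps)
  then show ?thesis by blast
qed

section \<open>Integrals over open intervals, and test functions\<close>

lemma integral_eq_superinterval:
  fixes f :: "real \<Rightarrow> real"
  assumes "continuous_on {a..c} f" "\<And>x. x \<notin> {a..c} \<Longrightarrow> f x = 0" "{a..c} \<subseteq> {p..q}"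
  shows "integral {p..q} f = integral {a..c} f"
proof -
  have "(f has_integral integral {a..c} f) {a..c}"
    using assms(1) by (simp add: integrable_integral integrable_continuous_real)
  then show ?thesis
    using has_integral_on_superset assms(2,3) integral_unique by metis
qed

lemma integrable_continuous_open_interval:
  fixes f :: "real \<Rightarrow> real"
  assumes "continuous_on {a..b} f"
  shows "integrable (lebesgue_on {a<..<b}) f"
proof -
  have "integrable (lebesgue_on {a..b}) f"
    by (rule continuous_imp_integrable_real[OF assms])
  then have "set_integrable lebesgue {a..b} f"
    by (simp add: integrable_restrict_space set_integrable_def)
  then have "set_integrable lebesgue {a<..<b} f"
    by (rule set_integrable_subset) auto
  then show ?thesis
    by (simp add: integrable_restrict_space set_integrable_def)
qed

text \<open>Links the Lebesgue integrals of the weak formulation to the gauge integral, in which the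
  fundamental theorem of calculus is available.\<close>

lemma lebesgue_on_open_interval_eq_integral:
  fixes f :: "real \<Rightarrow> real"
  assumes "continuous_on {a..b} f"
  shows "(LINT x|lebesgue_on {a<..<b}. f x) = integral {a..b} f"
  using lebesgue_integral_eq_integral[OF integrable_continuous_open_interval[OF assms]]
  by (simp add: integral_open_interval_real)

lemma continuous_in_L2:
  assumes "continuous_on {0..l} f"
  shows "f \<in> L2 l"
  unfolding L2_def
  using integrable_continuous_open_interval[OF assms]
    integrable_continuous_open_interval[of 0 l "\<lambda>x. (f x)\<^sup>2"] assms
  by (auto intro!: continuous_intros)

lemma test_functionD:
  assumes "\<phi> \<in> test_functions l"
  shows "(\<phi> has_real_derivative deriv \<phi> x) (at x)" "continuous_on S (deriv \<phi>)"
    "continuous_on S \<phi>" "\<phi> 0 = 0" "\<phi> l = 0"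
proof -
  obtain D where D: "\<And>x. (\<phi> has_vector_derivative D x) (at x)" "continuous_on UNIV D"
    using assms by (auto simp: test_functions_def C1_differentiable_on_def)
  then have DD: "(\<phi> has_real_derivative D x) (at x)" for x
    by (simp add: has_real_derivative_iff_has_vector_derivative)
  then have eq: "deriv \<phi> = D" by (auto simp: DERIV_imp_deriv)
  have "x \<in> closure {x. \<phi> x \<noteq> 0}" if "\<phi> x \<noteq> 0" for x
    using that by (intro closure_subset[THEN subsetD]) auto
  then have "\<phi> x = 0" if "x \<notin> {0<..<l}" for x
    using assms that unfolding test_functions_def by blast
  then show "\<phi> 0 = 0" "\<phi> l = 0" by auto
  have "continuous_on UNIV \<phi>"
    using DD by (meson DERIV_isCont continuous_at_imp_continuous_on)
  then show "continuous_on S \<phi>" by (rule continuous_on_subset) simp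
  show "continuous_on S (deriv \<phi>)"
    unfolding eq using D(2) by (rule continuous_on_subset) simp
  show "(\<phi> has_real_derivative deriv \<phi> x) (at x)" by (simp add: eq DD)
qed

lemma test_functionI:
  assumes "\<And>x. (\<phi> has_real_derivative \<psi> x) (at x)" "continuous_on UNIV \<psi>"
    and "\<And>x. x \<notin> {a..c} \<Longrightarrow> \<phi> x = 0" and "0 < a" "c < l"
  shows "\<phi> \<in> test_functions l"
proof -
  have "closure {x. \<phi> x \<noteq> 0} \<subseteq> {a..c}"
  proof (rule closure_minimal)
    show "{x. \<phi> x \<noteq> 0} \<subseteq> {a..c}"
    proof
      fix x assume "x \<in> {x. \<phi> x \<noteq> 0}"
      then show "x \<in> {a..c}" using assms(3)[of x] by fastforce
    qed
  qed simp
  also have "\<dots> \<subseteq> {0<..<l}" using assms(4,5) by auto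
  finally show ?thesis
    using assms(1,2) unfolding test_functions_def C1_differentiable_on_def
    by (auto simp: has_real_derivative_iff_has_vector_derivative)
qed

text \<open>Integration by parts; the boundary terms vanish because a test function is zero at
  \<open>0\<close> and \<open>l\<close>.\<close>

lemma weak_derivative_of_C1:
  assumes l: "0 < l"
    and der: "\<And>x. x \<in> {0..l} \<Longrightarrow> (f has_real_derivative f' x) (at x within {0..l})"
    and cont: "continuous_on {0..l} f'"
  shows "weak_derivative l f f'"
  unfolding weak_derivative_def
proof
  fix \<phi> assume \<phi>: "\<phi> \<in> test_functions l"
  note c' = test_functionD(2,3)[OF \<phi>] and z = test_functionD(4,5)[OF \<phi>]
  have cf: "continuous_on {0..l} f"
    using der DERIV_continuous_on by blast
  have "((\<lambda>x. f x * deriv \<phi> x + f' x * \<phi> x) has_integral (f l * \<phi> l - f 0 * \<phi> 0)) {0..l}"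
    using l by (intro fundamental_theorem_of_calculus)
      (auto simp flip: has_real_derivative_iff_has_vector_derivative
        intro!: derivative_eq_intros der DERIV_subset[OF test_functionD(1)[OF \<phi>]])
  then have "integral {0..l} (\<lambda>x. f x * deriv \<phi> x + f' x * \<phi> x) = 0"
    by (simp add: z integral_unique)
  moreover have "integral {0..l} (\<lambda>x. f x * deriv \<phi> x + f' x * \<phi> x)
     = integral {0..l} (\<lambda>x. f x * deriv \<phi> x) + integral {0..l} (\<lambda>x. f' x * \<phi> x)"
    by (intro integral_add integrable_continuous_real continuous_intros c' cf cont)
  ultimately show "(LINT x|lebesgue_on {0<..<l}. f x * deriv \<phi> x) =
     - (LINT x|lebesgue_on {0<..<l}. f' x * \<phi> x)"
    by (simp add: lebesgue_on_open_interval_eq_integral continuous_intros c' cf cont)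
qed

lemma C2_in_H2:
  assumes l: "0 < l"
    and der: "\<And>x. x \<in> {0..l} \<Longrightarrow> (f has_real_derivative f' x) (at x within {0..l})"
    and der': "\<And>x. x \<in> {0..l} \<Longrightarrow> (f' has_real_derivative f'' x) (at x within {0..l})"
    and cont: "continuous_on {0..l} f''"
  shows "f \<in> H2 l" and "weak_derivative2 l f f''"
proof -
  have c: "continuous_on {0..l} f" "continuous_on {0..l} f'"
    using der der' DERIV_continuous_on by blast+
  have w: "weak_derivative l f f'" "weak_derivative l f' f''"
    using weak_derivative_of_C1 assms c by blast+
  show "f \<in> H2 l" "weak_derivative2 l f f''"
    using w continuous_in_L2[OF c(1)] continuous_in_L2[OF c(2)] continuous_in_L2[OF cont]
    by (auto simp: H2_def H1_def weak_derivative2_def)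
qed

text \<open>A function \<psi> with vanishing zeroth and first moments is the second derivative of a
  test function \<Phi>. Testing both equations with it gives the same number, the integral of
  \<open>F * \<Phi>\<close>, so \<open>u - v\<close> is orthogonal to \<psi>. The interval
  \<open>{a..c}\<close> lies strictly inside because \<Phi> needs compact support in the open
  interval.\<close>

lemma weak_derivative2_eq_affine:
  assumes cu: "continuous_on {0..l} u" and cv: "continuous_on {0..l} v"
    and wu: "weak_derivative2 l u F" and wv: "weak_derivative2 l v F"
    and ac: "0 < a" "a < c" "c < l"
  shows "\<exists>A B. \<forall>x\<in>{a<..<c}. u x - v x = A + B * x"
proof (rule affine_if_orthogonal[OF \<open>a < c\<close>])
  have sub: "{a..c} \<subseteq> {0..l}" using ac by auto
  show cg: "continuous_on {a..c} (\<lambda>x. u x - v x)"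
    using cu cv sub by (auto intro!: continuous_intros intro: continuous_on_subset)
  fix \<psi> :: "real \<Rightarrow> real"
  assume c: "continuous_on UNIV \<psi>" and supp: "\<And>x. x \<notin> {a..c} \<Longrightarrow> \<psi> x = 0"
    and m0: "integral {a..c} \<psi> = 0" and m1: "integral {a..c} (\<lambda>x. x * \<psi> x) = 0"
  have cl: "continuous_on S \<psi>" for S using c continuous_on_subset by blast
  obtain \<Psi> where \<Psi>: "\<And>x. (\<Psi> has_real_derivative \<psi> x) (at x)" "\<And>x. x \<notin> {a..c} \<Longrightarrow> \<Psi> x = 0"
    using compact_antiderivative[OF c supp m0] by blast
  have c\<Psi>: "continuous_on S \<Psi>" for S
    using \<Psi>(1) by (meson DERIV_isCont continuous_at_imp_continuous_on)
  \<comment> \<open>Integration by parts turns the first-moment condition into a vanishing integral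
    of \<Psi>, which is what the second primitive requires.\<close>
  have "((\<lambda>x. x * \<psi> x + \<Psi> x) has_integral (l * \<Psi> l - 0 * \<Psi> 0)) {0..l}"
    using ac by (intro fundamental_theorem_of_calculus)
      (auto simp flip: has_real_derivative_iff_has_vector_derivative
        intro!: derivative_eq_intros DERIV_subset[OF \<Psi>(1)])
  then have "integral {0..l} (\<lambda>x. x * \<psi> x + \<Psi> x) = 0"
    using ac by (simp add: \<Psi> integral_unique)
  moreover have "integral {0..l} (\<lambda>x. x * \<psi> x + \<Psi> x)
     = integral {0..l} (\<lambda>x. x * \<psi> x) + integral {0..l} \<Psi>"
    by (intro integral_add integrable_continuous_real continuous_intros c\<Psi> cl)
  moreover have "integral {0..l} (\<lambda>x. x * \<psi> x) = integral {a..c} (\<lambda>x. x * \<psi> x)"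
    by (rule integral_eq_superinterval[OF _ _ sub]) (auto intro!: continuous_intros cl simp: supp)
  moreover have "integral {0..l} \<Psi> = integral {a..c} \<Psi>"
    by (rule integral_eq_superinterval[OF c\<Psi> _ sub]) (auto simp: \<Psi>)
  ultimately have "integral {a..c} \<Psi> = 0" using m1 by simp
  from compact_antiderivative[OF c\<Psi> \<Psi>(2) this]
  obtain \<Phi> where \<Phi>: "\<And>x. (\<Phi> has_real_derivative \<Psi> x) (at x)" "\<And>x. x \<notin> {a..c} \<Longrightarrow> \<Phi> x = 0"
    by blast
  have test: "\<Phi> \<in> test_functions l" "\<Psi> \<in> test_functions l"
    using test_functionI[OF \<Phi>(1) c\<Psi> \<Phi>(2)] test_functionI[OF \<Psi>(1) c \<Psi>(2)] ac by auto
  have derivs: "deriv \<Phi> = \<Psi>" "deriv \<Psi> = \<psi>"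
    using \<Phi>(1) \<Psi>(1) by (auto simp: DERIV_imp_deriv)
  \<comment> \<open>The first weak derivative is tested with \<Psi>, the second with \<Phi>; the two
    minus signs cancel.\<close>
  have weak: "integral {0..l} (\<lambda>x. f x * \<psi> x) = (LINT x|lebesgue_on {0<..<l}. F x * \<Phi> x)"
    if "weak_derivative2 l f F" "continuous_on {0..l} f" for f
  proof -
    obtain w where "weak_derivative l f w" "weak_derivative l w F"
      using \<open>weak_derivative2 l f F\<close> by (auto simp: weak_derivative2_def)
    then have "(LINT x|lebesgue_on {0<..<l}. f x * \<psi> x) = (LINT x|lebesgue_on {0<..<l}. F x * \<Phi> x)"
      using test derivs unfolding weak_derivative_def by fastforce
    then show ?thesis
      by (simp add: lebesgue_on_open_interval_eq_integral continuous_intros cl that)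
  qed
  have "integral {a..c} (\<lambda>x. (u x - v x) * \<psi> x) = integral {0..l} (\<lambda>x. (u x - v x) * \<psi> x)"
    by (rule integral_eq_superinterval[OF _ _ sub, symmetric])
       (auto intro!: continuous_intros cg cl simp: supp)
  also have "\<dots> = integral {0..l} (\<lambda>x. u x * \<psi> x - v x * \<psi> x)"
    by (simp add: algebra_simps)
  also have "\<dots> = integral {0..l} (\<lambda>x. u x * \<psi> x) - integral {0..l} (\<lambda>x. v x * \<psi> x)"
    by (intro integral_diff integrable_continuous_real continuous_intros cl cu cv)
  finally show "integral {a..c} (\<lambda>x. (u x - v x) * \<psi> x) = 0"
    using weak[OF wu cu] weak[OF wv cv] by simp
qed

text \<open>The affine function found for \<open>u - v\<close> may a priori depend on the
  subinterval. A fixed middle interval serves as reference, continuity reaches the endpoints, and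
  the equal boundary values force the affine function to vanish.\<close>

lemma weak_derivative2_unique:
  assumes l: "0 < l" and cu: "continuous_on {0..l} u" and cv: "continuous_on {0..l} v"
    and wu: "weak_derivative2 l u F" and wv: "weak_derivative2 l v F"
    and bd: "u 0 = v 0" "u l = v l" and x: "x \<in> {0..l}"
  shows "u x = v x"
proof -
  note aff = weak_derivative2_eq_affine[OF cu cv wu wv]
  obtain A B where AB: "\<And>x. x \<in> {l/4<..<3*l/4} \<Longrightarrow> u x - v x = A + B * x"
    using aff[of "l/4" "3*l/4"] l by auto
  have inner: "u x - v x = A + B * x" if "x \<in> {0<..<l}" for x
  proof -
    \<comment> \<open>Chosen so that the open interval from \<open>a\<close> to \<open>c\<close>
      contains \<open>x\<close> and also the reference points \<open>l/3\<close> and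
      \<open>l/2\<close>, while staying away from \<open>0\<close> and \<open>l\<close>.\<close>
    define a where "a = min (x/2) (l/4)"
    define c where "c = max ((x+l)/2) (3*l/4)"
    have ac: "0 < a" "a < c" "c < l" "x \<in> {a<..<c}" "l/3 \<in> {a<..<c}" "l/2 \<in> {a<..<c}"
      using that by (auto simp: a_def c_def min_def max_def)
    obtain A' B' where AB': "\<And>x. x \<in> {a<..<c} \<Longrightarrow> u x - v x = A' + B' * x"
      using aff[OF ac(1-3)] by auto
    \<comment> \<open>Two affine functions that agree at two distinct points coincide.\<close>
    have e3: "A + B * (l/3) = A' + B' * (l/3)" and e2: "A + B * (l/2) = A' + B' * (l/2)"
      using AB[of "l/3"] AB[of "l/2"] AB'[of "l/3"] AB'[of "l/2"] ac l by auto
    have "(A + B * (l/2)) - (A + B * (l/3)) = (A' + B' * (l/2)) - (A' + B' * (l/3))"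
      by (simp only: e2 e3)
    then have "(B - B') * (l / 6) = 0" by (simp add: algebra_simps)
    then have B: "B = B'" using l by simp
    have "A = A'" using e2 unfolding B by (rule add_right_imp_eq)
    then show ?thesis using AB'[OF ac(4)] B by (simp only:)
  qed
  have all: "u x - v x - (A + B * x) = 0" if "x \<in> {0..l}" for x
  proof (rule continuous_constant_on_closure[where f = "\<lambda>x. u x - v x - (A + B * x)" and S = "{0<..<l}"])
    have "closure {0<..<l} = {0..l}" using l by simp
    then show "continuous_on (closure {0<..<l}) (\<lambda>x. u x - v x - (A + B * x))"
      and "x \<in> closure {0<..<l}"
      using cu cv that by (auto intro!: continuous_intros)
    show "u y - v y - (A + B * y) = 0" if "y \<in> {0<..<l}" for y
      using inner[OF that] by simp
  qed
  have "A = 0" using all[of 0] bd l by simp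
  then have "B = 0" using all[of l] bd l by simp
  show ?thesis using all[OF x] \<open>A = 0\<close> \<open>B = 0\<close> by simp
qed

section \<open>Connectedness\<close>

text \<open>Passes from topological to combinatorial connectedness: otherwise a level set of
  \<open>w\<close>, extended along the edges, and its complement would disconnect the space.\<close>

lemma connected_graph_constant:
  assumes G: "metric_graph G" and conn: "connected_graph G"
    and edge: "\<And>e. e \<in> edges G \<Longrightarrow> w (tail G e) = w (head G e)"
    and v: "v \<in> verts G" "v' \<in> verts G"
  shows "w v = w v'"
proof (rule ccontr)
  assume neq: "w v \<noteq> w v'"
  \<comment> \<open>The extension of \<open>w\<close> is constant along each closed edge, so the
    preimage of any set of values meets an edge in all of it or not at all, and is therefore
    open.\<close>
  define f where "f p = (case p of Vertex v \<Rightarrow> w v | Interior e x \<Rightarrow> w (tail G e))" for p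
  have f: "f (edge_point G e x) = w (tail G e)" if "e \<in> edges G" for e x
    using edge[OF that] by (simp add: f_def edge_point_def)
  have op: "openin (graph_topology G) {p \<in> points G. P (f p)}" for P
  proof -
    have "openin (top_of_set {0..len G e})
        {x \<in> {0..len G e}. edge_point G e x \<in> {p \<in> points G. P (f p)}}" if "e \<in> edges G" for e
    proof -
      have "{x \<in> {0..len G e}. edge_point G e x \<in> {p \<in> points G. P (f p)}}
          = (if P (w (tail G e)) then {0..len G e} else {})"
        using f[OF that] edge_point_in_points[OF G that] by auto
      then show ?thesis by simp
    qed
    then show ?thesis unfolding openin_graph_topology by blast
  qed
  have "connected_space (graph_topology G)"
    using conn path_connected_imp_connected_space unfolding connected_graph_def by blast
  moreover have "Vertex v \<in> {p \<in> points G. f p = w v}" "Vertex v' \<in> {p \<in> points G. f p \<noteq> w v}"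
    using v neq by (auto simp: points_def f_def)
  moreover have "topspace (graph_topology G) \<subseteq> {p \<in> points G. f p = w v} \<union> {p \<in> points G. f p \<noteq> w v}"
    using topspace_graph_topology[OF G] by auto
  moreover have "{p \<in> points G. f p = w v} \<inter> {p \<in> points G. f p \<noteq> w v} = {}" by auto
  ultimately show False
    using op[of "\<lambda>y. y = w v"] op[of "\<lambda>y. y \<noteq> w v"] unfolding connected_space_def
    by (metis (no_types, lifting) emptyE)
qed

section \<open>Square linear systems\<close>

text \<open>Gaussian elimination, by induction on the set of equations: an equation with a nonzero
  coefficient is used to eliminate one unknown.\<close>

lemma homogeneous_system_nontrivial:
  fixes A :: "'b \<Rightarrow> 'a \<Rightarrow> real"
  assumes "finite E" "finite V" "card E < card V"
  shows "\<exists>x. (\<exists>v\<in>V. x v \<noteq> 0) \<and> (\<forall>e\<in>E. (\<Sum>v\<in>V. A e v * x v) = 0)"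
  using assms
proof (induction E arbitrary: V A rule: finite_induct)
  case empty
  then have "V \<noteq> {}" by auto
  then show ?case by (intro exI[of _ "\<lambda>_. 1"]) auto
next
  case (insert e E)
  show ?case
  proof (cases "\<forall>v\<in>V. A e v = 0")
    case True
    have "card E < card V" using insert by simp
    from insert.IH[OF \<open>finite V\<close> this, of A] show ?thesis using True by force
  next
    case False
    then obtain p where p: "p \<in> V" "A e p \<noteq> 0" by auto
    \<comment> \<open>The remaining rows after elimination with pivot \<open>p\<close> in row
      \<open>e\<close>.\<close>
    define A' where "A' f v = A f v - A f p * A e v / A e p" for f v
    have "card E < card (V - {p})" using insert p by simp
    from insert.IH[OF _ this, of A'] insert.prems obtain x
      where x: "\<exists>v\<in>V-{p}. x v \<noteq> 0" "\<And>f. f \<in> E \<Longrightarrow> (\<Sum>v\<in>V-{p}. A' f v * x v) = 0" by auto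
    define s where "s = (\<Sum>v\<in>V-{p}. A e v * x v)"
    \<comment> \<open>Back substitution: the value at \<open>p\<close> is the one that satisfies
      equation \<open>e\<close>.\<close>
    define y where "y = x(p := - s / A e p)"
    have sum_y: "(\<Sum>v\<in>V. A f v * y v) = - A f p * s / A e p + (\<Sum>v\<in>V-{p}. A f v * x v)" for f
    proof -
      have "(\<Sum>v\<in>V. A f v * y v) = A f p * y p + (\<Sum>v\<in>V-{p}. A f v * y v)"
        using p insert.prems by (simp add: sum.remove)
      also have "(\<Sum>v\<in>V-{p}. A f v * y v) = (\<Sum>v\<in>V-{p}. A f v * x v)"
        by (rule sum.cong) (auto simp: y_def)
      finally show ?thesis by (simp add: y_def)
    qed
    have "(\<Sum>v\<in>V. A f v * y v) = 0" if "f \<in> E" for f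
    proof -
      have "(\<Sum>v\<in>V-{p}. A' f v * x v) = (\<Sum>v\<in>V-{p}. A f v * x v) - A f p / A e p * s"
        unfolding s_def sum_distrib_left sum_subtractf[symmetric]
        by (rule sum.cong) (simp_all add: A'_def algebra_simps)
      then show ?thesis using x(2)[OF that] by (simp add: sum_y)
    qed
    moreover have "(\<Sum>v\<in>V. A e v * y v) = 0" using p by (simp add: sum_y s_def)
    moreover have "\<exists>v\<in>V. y v \<noteq> 0" using x(1) by (auto simp: y_def)
    ultimately show ?thesis by auto
  qed
qed

text \<open>With the extra column \<open>- b\<close>, indexed by \<open>None\<close>, there are more
  unknowns than equations. Injectivity excludes a zero \<open>None\<close> coordinate in a
  nontrivial solution, and dividing by it solves the system.\<close>

lemma injective_system_solvable:
  fixes A :: "'a \<Rightarrow> 'a \<Rightarrow> real" and b :: "'a \<Rightarrow> real"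
  assumes V: "finite V"
    and inj: "\<forall>x. (\<forall>u\<in>V. (\<Sum>w\<in>V. A u w * x w) = 0) \<longrightarrow> (\<forall>v\<in>V. x v = 0)"
  shows "\<exists>x. \<forall>u\<in>V. (\<Sum>w\<in>V. A u w * x w) = b u"
proof -
  define B where "B u w = (case w of None \<Rightarrow> - b u | Some w \<Rightarrow> A u w)" for u w
  let ?V = "insert None (Some ` V)"
  have card: "card V < card ?V" using V by (simp add: card_insert_if card_image)
  obtain y where y: "\<exists>w\<in>?V. y w \<noteq> 0" "\<And>u. u \<in> V \<Longrightarrow> (\<Sum>w\<in>?V. B u w * y w) = 0"
    using homogeneous_system_nontrivial[OF V _ card, of B] V by auto
  have eq: "(\<Sum>w\<in>V. A u w * y (Some w)) = b u * y None" if "u \<in> V" for u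
    using y(2)[OF that] V by (simp add: B_def sum.reindex)
  have "y None \<noteq> 0"
  proof
    assume z: "y None = 0"
    then have "y (Some w) = 0" if "w \<in> V" for w
      using inj[rule_format, of "\<lambda>w. y (Some w)" w] eq that by simp
    then show False using y(1) z by auto
  qed
  then have "(\<Sum>w\<in>V. A u w * (y (Some w) / y None)) = b u" if "u \<in> V" for u
    using eq[OF that] by (simp flip: sum_divide_distrib)
  then show ?thesis by (intro exI[of _ "\<lambda>w. y (Some w) / y None"]) simp
qed

section \<open>The discrete energy\<close>

text \<open>The edge sum is the Dirichlet form of the edgewise affine interpolations of the vertex
  values, as in linear finite elements.\<close>

definition energy :: "('v, 'e) mgraph \<Rightarrow> ('v \<Rightarrow> real) \<Rightarrow> ('v \<Rightarrow> real) \<Rightarrow> ('v \<Rightarrow> real) \<Rightarrow> real" where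
  "energy G \<alpha> U W =
     (\<Sum>e\<in>edges G. (U (head G e) - U (tail G e)) * (W (head G e) - W (tail G e)) / len G e) +
     (\<Sum>v\<in>verts G. \<alpha> v * U v * W v)"

text \<open>The trapezoidal formula: this is the integral over the graph of the edgewise affine
  interpolation of \<open>W\<close>.\<close>

definition load :: "('v, 'e) mgraph \<Rightarrow> ('v \<Rightarrow> real) \<Rightarrow> real" where
  "load G W = (\<Sum>e\<in>edges G. len G e / 2 * (W (head G e) + W (tail G e)))"

lemma energy_commute: "energy G \<alpha> U W = energy G \<alpha> W U"
  by (simp add: energy_def mult_ac)

lemma energy_diff_left: "energy G \<alpha> (\<lambda>v. U v - U' v) W = energy G \<alpha> U W - energy G \<alpha> U' W"
  unfolding energy_def
  by (simp add: algebra_simps diff_divide_distrib add_divide_distrib sum.distrib sum_subtractf)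

lemma energy_diff_right: "energy G \<alpha> W (\<lambda>v. U v - U' v) = energy G \<alpha> W U - energy G \<alpha> W U'"
  by (metis energy_commute energy_diff_left)

lemma energy_nonneg:
  assumes "metric_graph G" "\<forall>v\<in>verts G. 0 \<le> \<alpha> v"
  shows "0 \<le> energy G \<alpha> W W"
  using assms unfolding energy_def metric_graph_def mult.assoc
  by (intro add_nonneg_nonneg sum_nonneg divide_nonneg_pos mult_nonneg_nonneg[OF _ zero_le_square]
      zero_le_square) auto

lemma energy_eq_0D:
  assumes G: "metric_graph G" and \<alpha>: "\<forall>v\<in>verts G. 0 \<le> \<alpha> v" and 0: "energy G \<alpha> W W = 0"
  shows "\<And>e. e \<in> edges G \<Longrightarrow> W (tail G e) = W (head G e)"
    and "\<And>v. v \<in> verts G \<Longrightarrow> \<alpha> v \<noteq> 0 \<Longrightarrow> W v = 0"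
proof -
  let ?f = "\<lambda>e. (W (head G e) - W (tail G e)) * (W (head G e) - W (tail G e)) / len G e"
  let ?g = "\<lambda>v. \<alpha> v * W v * W v"
  have fin: "finite (edges G)" "finite (verts G)" using G by (auto simp: metric_graph_def)
  have f: "0 \<le> ?f e" if "e \<in> edges G" for e
    using G that by (intro divide_nonneg_pos) (auto simp: metric_graph_def)
  have g: "0 \<le> ?g v" if "v \<in> verts G" for v
    using \<alpha> that unfolding mult.assoc by (intro mult_nonneg_nonneg[OF _ zero_le_square]) auto
  have "sum ?f (edges G) + sum ?g (verts G) = 0" using 0 by (simp add: energy_def)
  moreover have "0 \<le> sum ?f (edges G)" "0 \<le> sum ?g (verts G)" using f g by (auto intro: sum_nonneg)
  ultimately have z: "sum ?f (edges G) = 0" "sum ?g (verts G) = 0" by linarith+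
  show "W (tail G e) = W (head G e)" if "e \<in> edges G" for e
  proof -
    have "?f e = 0" using z(1) f fin that by (subst (asm) sum_nonneg_eq_0_iff) auto
    moreover have "len G e \<noteq> 0" using G that by (auto simp: metric_graph_def)
    ultimately show ?thesis by simp
  qed
  show "W v = 0" if "v \<in> verts G" "\<alpha> v \<noteq> 0" for v
  proof -
    have "?g v = 0" using z(2) g fin that by (subst (asm) sum_nonneg_eq_0_iff) auto
    then show ?thesis using that by simp
  qed
qed

abbreviation vertex_indicator :: "'v \<Rightarrow> 'v \<Rightarrow> real" where
  "vertex_indicator v \<equiv> (\<lambda>x. of_bool (x = v))"

lemma sum_vertex_indicator:
  assumes "finite V" "x \<in> V"
  shows "(\<Sum>v\<in>V. W v * vertex_indicator v x) = W x"
  using assms by (simp add: of_bool_def if_distrib[of "\<lambda>y. _ * y"] cong: if_cong)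

text \<open>Linearity in the second argument. Together with \<open>load_expand\<close> it reduces
  testing against all \<open>W\<close> to testing against the finitely many vertex
  indicators.\<close>

lemma energy_expand:
  assumes G: "metric_graph G"
  shows "energy G \<alpha> U W = (\<Sum>v\<in>verts G. W v * energy G \<alpha> U (vertex_indicator v))"
proof -
  have fin: "finite (edges G)" "finite (verts G)"
    and ends: "\<And>e. e \<in> edges G \<Longrightarrow> head G e \<in> verts G" "\<And>e. e \<in> edges G \<Longrightarrow> tail G e \<in> verts G"
    using G by (auto simp: metric_graph_def)
  note ind = sum_vertex_indicator[OF fin(2)]
  let ?c = "\<lambda>e. (U (head G e) - U (tail G e)) / len G e"
  have "(\<Sum>v\<in>verts G. W v * energy G \<alpha> U (vertex_indicator v)) =
      (\<Sum>v\<in>verts G. \<Sum>e\<in>edges G. ?c e * (W v * vertex_indicator v (head G e) - W v * vertex_indicator v (tail G e)))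
    + (\<Sum>v\<in>verts G. \<Sum>x\<in>verts G. \<alpha> x * U x * (W v * vertex_indicator v x))"
    by (simp add: energy_def distrib_left sum.distrib sum_distrib_left algebra_simps
        diff_divide_distrib add_divide_distrib)
  also have "(\<Sum>v\<in>verts G. \<Sum>e\<in>edges G. ?c e * (W v * vertex_indicator v (head G e) - W v * vertex_indicator v (tail G e)))
     = (\<Sum>e\<in>edges G. ?c e * (W (head G e) - W (tail G e)))"
    by (subst sum.swap, rule sum.cong)
       (simp_all only: sum_distrib_left[symmetric] sum_subtractf ind ends)
  also have "(\<Sum>v\<in>verts G. \<Sum>x\<in>verts G. \<alpha> x * U x * (W v * vertex_indicator v x))
     = (\<Sum>x\<in>verts G. \<alpha> x * U x * W x)"
    by (subst sum.swap, rule sum.cong) (simp_all only: sum_distrib_left[symmetric] ind)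
  finally show ?thesis by (simp add: energy_def)
qed

lemma load_expand:
  assumes G: "metric_graph G"
  shows "load G W = (\<Sum>v\<in>verts G. W v * load G (vertex_indicator v))"
proof -
  have fin: "finite (edges G)" "finite (verts G)"
    and ends: "\<And>e. e \<in> edges G \<Longrightarrow> head G e \<in> verts G" "\<And>e. e \<in> edges G \<Longrightarrow> tail G e \<in> verts G"
    using G by (auto simp: metric_graph_def)
  note ind = sum_vertex_indicator[OF fin(2)]
  have "(\<Sum>v\<in>verts G. W v * load G (vertex_indicator v)) =
      (\<Sum>v\<in>verts G. \<Sum>e\<in>edges G. len G e / 2 * (W v * vertex_indicator v (head G e) + W v * vertex_indicator v (tail G e)))"
    by (simp add: load_def sum_distrib_left algebra_simps)
  also have "\<dots> = (\<Sum>e\<in>edges G. len G e / 2 * (W (head G e) + W (tail G e)))"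
    by (subst sum.swap, rule sum.cong)
       (simp_all only: sum_distrib_left[symmetric] sum.distrib ind ends)
  finally show ?thesis by (simp add: load_def)
qed

text \<open>Isolated as a notion because the original graph obtains it from its own connectedness,
  the enlarged graph from the connectedness of its two pieces.\<close>

definition energy_definite :: "('v, 'e) mgraph \<Rightarrow> ('v \<Rightarrow> real) \<Rightarrow> bool" where
  "energy_definite G \<alpha> \<longleftrightarrow> (\<forall>W. energy G \<alpha> W W = 0 \<longrightarrow> (\<forall>v\<in>verts G. W v = 0))"

text \<open>Zero energy makes \<open>W\<close> constant along edges, hence globally constant, and
  zero at a vertex with nonzero strength.\<close>

lemma connected_energy_definite:
  assumes G: "metric_graph G" "connected_graph G"
    and \<alpha>: "\<forall>v\<in>verts G. 0 \<le> \<alpha> v" "\<exists>v\<in>verts G. \<alpha> v \<noteq> 0"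
  shows "energy_definite G \<alpha>"
  unfolding energy_definite_def
proof (intro allI impI ballI)
  fix W v assume W: "energy G \<alpha> W W = 0" and v: "v \<in> verts G"
  obtain u where u: "u \<in> verts G" "\<alpha> u \<noteq> 0" using \<alpha>(2) by auto
  have "W v = W u"
    by (rule connected_graph_constant[OF G _ v u(1)]) (rule energy_eq_0D(1)[OF G(1) \<alpha>(1) W])
  then show "W v = 0" using energy_eq_0D(2)[OF G(1) \<alpha>(1) W u] by simp
qed

section \<open>The discrete torsion problem: solvability, uniqueness and variational
  principle\<close>

definition torsion_values :: "('v, 'e) mgraph \<Rightarrow> ('v \<Rightarrow> real) \<Rightarrow> ('v \<Rightarrow> real) \<Rightarrow> bool" where
  "torsion_values G \<alpha> U \<longleftrightarrow> (\<forall>W. energy G \<alpha> U W = load G W)"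

text \<open>The matrix is the energy form on vertex indicators. Pairing a kernel vector with itself
  gives zero energy, so definiteness yields injectivity and thus solvability.\<close>

lemma torsion_values_exist:
  assumes G: "metric_graph G" and def: "energy_definite G \<alpha>"
  obtains U where "torsion_values G \<alpha> U"
proof -
  have fin: "finite (verts G)" using G by (auto simp: metric_graph_def)
  define A where "A u w = energy G \<alpha> (vertex_indicator u) (vertex_indicator w)" for u w
  have A: "(\<Sum>w\<in>verts G. A u w * x w) = energy G \<alpha> x (vertex_indicator u)" for x u
    using energy_expand[OF G, of \<alpha> "vertex_indicator u" x]
    by (simp add: A_def energy_commute[of _ _ x] mult.commute)
  have "\<forall>x. (\<forall>u\<in>verts G. (\<Sum>w\<in>verts G. A u w * x w) = 0) \<longrightarrow> (\<forall>v\<in>verts G. x v = 0)"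
  proof (intro allI impI)
    fix x assume "\<forall>u\<in>verts G. (\<Sum>w\<in>verts G. A u w * x w) = 0"
    then have "energy G \<alpha> x x = 0"
      unfolding A by (subst energy_expand[OF G]) simp
    then show "\<forall>v\<in>verts G. x v = 0" using def by (auto simp: energy_definite_def)
  qed
  from injective_system_solvable[OF fin this, of "\<lambda>u. load G (vertex_indicator u)"]
  obtain U where "\<And>u. u \<in> verts G \<Longrightarrow> (\<Sum>w\<in>verts G. A u w * U w) = load G (vertex_indicator u)"
    by blast
  then have "energy G \<alpha> U W = load G W" for W
    unfolding A by (simp add: energy_expand[OF G, of _ U W] load_expand[OF G, of W])
  then have "torsion_values G \<alpha> U" by (simp add: torsion_values_def)
  then show ?thesis by (rule that)
qed

lemma torsion_values_unique:
  assumes def: "energy_definite G \<alpha>" and "torsion_values G \<alpha> U" "torsion_values G \<alpha> U'" "v \<in> verts G"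
  shows "U v = U' v"
proof -
  have "energy G \<alpha> (\<lambda>v. U v - U' v) (\<lambda>v. U v - U' v) = 0"
    using assms(2,3) by (simp add: energy_diff_left torsion_values_def)
  then show ?thesis using def assms(4) unfolding energy_definite_def by fastforce
qed

text \<open>Completing the square: the difference of the two sides is the energy of
  \<open>U - W\<close>.\<close>

lemma load_minus_energy_maximal:
  assumes G: "metric_graph G" and \<alpha>: "\<forall>v\<in>verts G. 0 \<le> \<alpha> v" and U: "torsion_values G \<alpha> U"
  shows "2 * load G W - energy G \<alpha> W W \<le> load G U"
proof -
  have "energy G \<alpha> (\<lambda>v. U v - W v) (\<lambda>v. U v - W v) =
      energy G \<alpha> U U - 2 * energy G \<alpha> U W + energy G \<alpha> W W"
    by (simp add: energy_diff_left energy_diff_right energy_commute[of _ _ W U])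
  then show ?thesis
    using energy_nonneg[OF G \<alpha>, of "\<lambda>v. U v - W v"] U by (simp add: torsion_values_def)
qed

text \<open>Testing with the indicator of \<open>v\<close> isolates the vertex condition at
  \<open>v\<close>; the two sums are the inward-pointing end derivatives of the edge
  quadratics.\<close>

lemma torsion_values_iff:
  assumes G: "metric_graph G"
  shows "torsion_values G \<alpha> U \<longleftrightarrow> (\<forall>v\<in>verts G.
     (\<Sum>e\<in>{e\<in>edges G. head G e = v}. (U (head G e) - U (tail G e)) / len G e - len G e / 2) +
     (\<Sum>e\<in>{e\<in>edges G. tail G e = v}. (U (tail G e) - U (head G e)) / len G e - len G e / 2) +
     \<alpha> v * U v = 0)" (is "_ = (\<forall>v\<in>verts G. ?S v = 0)")
proof -
  have fin: "finite (edges G)" "finite (verts G)"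
    using G by (auto simp: metric_graph_def)
  have "energy G \<alpha> U (vertex_indicator v) - load G (vertex_indicator v) = ?S v" if "v \<in> verts G" for v
  proof -
    have alpha_sum: "(\<Sum>x\<in>verts G. \<alpha> x * U x * vertex_indicator v x) = \<alpha> v * U v"
      using sum.delta[OF fin(2), of v "\<lambda>x. \<alpha> x * U x"] that
      by (simp add: of_bool_def if_distrib[of "\<lambda>y. _ * y"] eq_commute cong: if_cong)
    \<comment> \<open>The case split includes loops at \<open>v\<close>: there the difference
      quotients cancel and \<open>len G e / 2\<close> is subtracted twice.\<close>
    have summand: "(if head G e = v then (U (head G e) - U (tail G e)) / len G e - len G e / 2 else 0) +
        (if tail G e = v then (U (tail G e) - U (head G e)) / len G e - len G e / 2 else 0) =
        (U (head G e) - U (tail G e)) *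
        (vertex_indicator v (head G e) - vertex_indicator v (tail G e)) / len G e
         - len G e / 2 * (vertex_indicator v (head G e) + vertex_indicator v (tail G e))" for e
      by (cases "head G e = v"; cases "tail G e = v") (simp_all add: diff_divide_distrib)
    have "?S v = (\<Sum>e\<in>edges G. if head G e = v then (U (head G e) - U (tail G e)) / len G e - len G e / 2 else 0) +
     (\<Sum>e\<in>edges G. if tail G e = v then (U (tail G e) - U (head G e)) / len G e - len G e / 2 else 0) + \<alpha> v * U v"
      by (simp only: sum.inter_filter[OF fin(1)])
    also have "\<dots> = (\<Sum>e\<in>edges G. (U (head G e) - U (tail G e)) *
        (vertex_indicator v (head G e) - vertex_indicator v (tail G e)) / len G e
         - len G e / 2 * (vertex_indicator v (head G e) + vertex_indicator v (tail G e))) + \<alpha> v * U v"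
      unfolding sum.distrib[symmetric]
      by (intro arg_cong2[of _ _ _ _ "(+)"] sum.cong refl) (rule summand)
    finally show ?thesis
      by (simp add: energy_def load_def sum_subtractf alpha_sum)
  qed
  then have "(\<forall>v\<in>verts G. ?S v = 0) \<longleftrightarrow>
      (\<forall>v\<in>verts G. energy G \<alpha> U (vertex_indicator v) = load G (vertex_indicator v))"
    by force
  also have "\<dots> \<longleftrightarrow> torsion_values G \<alpha> U"
  proof
    assume *: "\<forall>v\<in>verts G. energy G \<alpha> U (vertex_indicator v) = load G (vertex_indicator v)"
    show "torsion_values G \<alpha> U"
      unfolding torsion_values_def
    proof
      fix W show "energy G \<alpha> U W = load G W"
        unfolding energy_expand[OF G, of _ U W] load_expand[OF G, of W]
        by (rule sum.cong) (use * in auto)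
    qed
  qed (simp add: torsion_values_def)
  finally show ?thesis by simp
qed

section \<open>The torsion function\<close>

text \<open>The solution of \<open>- y'' = 1\<close> with end values \<open>p\<close> and
  \<open>q\<close>: affine interpolation plus the torsion function of the interval with zero end
  values.\<close>

definition edge_torsion :: "real \<Rightarrow> real \<Rightarrow> real \<Rightarrow> real \<Rightarrow> real" where
  "edge_torsion p q l x = p + (q - p) * x / l + x * (l - x) / 2"

lemma edge_torsion_ends: "edge_torsion p q l 0 = p" "0 < l \<Longrightarrow> edge_torsion p q l l = q"
  by (simp_all add: edge_torsion_def)

text \<open>Formulated for any \<open>f\<close> that agrees with the quadratic on
  \<open>{0..l}\<close>, because a restriction to an edge is controlled only there.\<close>

lemma edge_torsion_deriv:
  assumes "\<And>x. x \<in> {0..l} \<Longrightarrow> f x = edge_torsion p q l x" and x: "x \<in> {0..l}"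
  shows "(f has_real_derivative (q - p) / l + l / 2 - x) (at x within {0..l})"
proof -
  have "(edge_torsion p q l has_real_derivative (q - p) / l + l / 2 - x) (at x within {0..l})"
  proof -
    have "edge_torsion p q l = (\<lambda>x. p + (q - p) / l * x + (l * x - x * x) / 2)"
      by (auto simp: edge_torsion_def right_diff_distrib mult.commute)
    then show ?thesis by (auto intro!: derivative_eq_intros simp: diff_divide_distrib)
  qed
  then show ?thesis
    by (rule has_field_derivative_transform_within[OF _ zero_less_one x]) (simp add: assms(1))
qed

lemma edge_torsion_weak:
  assumes l: "0 < l" and f: "\<And>x. x \<in> {0..l} \<Longrightarrow> f x = edge_torsion p q l x"
  shows "f \<in> H2 l" and "weak_derivative2 l f (\<lambda>_. - 1)"
proof -
  have d: "((\<lambda>x. (q - p) / l + l / 2 - x) has_real_derivative - 1) (at x within {0..l})" for x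
    by (auto intro!: derivative_eq_intros)
  show "f \<in> H2 l" "weak_derivative2 l f (\<lambda>_. - 1)"
    using C2_in_H2[OF l edge_torsion_deriv[OF f] d continuous_on_const] by blast+
qed

text \<open>The affine part gives the trapezoidal term, and \<open>x * (l - x) / 2\<close>
  integrates to \<open>l ^ 3 / 12\<close>.\<close>

lemma edge_torsion_integral:
  assumes l: "0 < l" and f: "\<And>x. x \<in> {0..l} \<Longrightarrow> f x = edge_torsion p q l x"
  shows "(LINT x|lebesgue_on {0..l}. f x) = l / 2 * (q + p) + l ^ 3 / 12"
proof -
  have "continuous_on {0..l} f"
    using edge_torsion_deriv[OF f] DERIV_continuous_on by blast
  then have "(LINT x|lebesgue_on {0..l}. f x) = integral {0..l} f"
    by (simp add: continuous_imp_integrable_real lebesgue_integral_eq_integral)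
  also have "\<dots> = integral {0..l} (edge_torsion p q l)"
    by (rule integral_cong) (rule f)
  also have "\<dots> = l / 2 * (q + p) + l ^ 3 / 12"
  proof -
    let ?F = "\<lambda>x. p * x + (q - p) * x\<^sup>2 / (2 * l) + l * x\<^sup>2 / 4 - x ^ 3 / 6"
    have "(?F has_real_derivative edge_torsion p q l x) (at x within {0..l})" for x
      using l by (auto intro!: derivative_eq_intros simp: edge_torsion_def field_simps power2_eq_square)
    then have "(edge_torsion p q l has_integral ?F l - ?F 0) {0..l}"
      using l by (intro fundamental_theorem_of_calculus)
        (auto simp flip: has_real_derivative_iff_has_vector_derivative)
    then have "integral {0..l} (edge_torsion p q l) = ?F l - ?F 0" by (rule integral_unique)
    also have "(q - p) * l\<^sup>2 / (2 * l) = (q - p) * l / 2" using l by (simp add: power2_eq_square)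
    finally show ?thesis by (simp add: field_simps power2_eq_square power3_eq_cube)
  qed
  finally show ?thesis .
qed

definition torsion_extension ::
  "('v, 'e) mgraph \<Rightarrow> ('v \<Rightarrow> real) \<Rightarrow> ('v, 'e) gpoint \<Rightarrow> real" where
  "torsion_extension G U = restrict (\<lambda>p. case p of Vertex v \<Rightarrow> U v
     | Interior e x \<Rightarrow> edge_torsion (U (tail G e)) (U (head G e)) (len G e) x) (points G)"

lemma torsion_extension_Vertex: "v \<in> verts G \<Longrightarrow> torsion_extension G U (Vertex v) = U v"
  by (simp add: torsion_extension_def points_def)

lemma restrict_edge_torsion_extension:
  assumes G: "metric_graph G" and e: "e \<in> edges G" and x: "x \<in> {0..len G e}"
  shows "restrict_edge G (torsion_extension G U) e x =
    edge_torsion (U (tail G e)) (U (head G e)) (len G e) x"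
proof -
  have "0 < len G e" using G e by (auto simp: metric_graph_def)
  then show ?thesis
    using edge_point_in_points[OF G e x]
    by (simp add: restrict_edge_def torsion_extension_def)
       (simp add: edge_point_def edge_torsion_ends)
qed

text \<open>In the quotient topology openness is checked edge by edge, where the function is a
  quadratic polynomial.\<close>

lemma torsion_extension_continuous:
  assumes G: "metric_graph G"
  shows "continuous_map (graph_topology G) euclideanreal (torsion_extension G U)"
  unfolding continuous_map_def
proof (intro conjI allI impI)
  let ?u = "torsion_extension G U"
  fix T :: "real set" assume T: "openin euclideanreal T"
  have "openin (top_of_set {0..len G e})
      {x \<in> {0..len G e}. edge_point G e x \<in> {p \<in> points G. ?u p \<in> T}}" if e: "e \<in> edges G" for e
  proof -
    have "continuous_on {0..len G e} (restrict_edge G ?u e)"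
      using edge_torsion_deriv[OF restrict_edge_torsion_extension[OF G e]] DERIV_continuous_on by blast
    then have "openin (top_of_set {0..len G e}) ({0..len G e} \<inter> restrict_edge G ?u e -` T)"
      using T continuous_openin_preimage_gen by auto
    moreover have "{0..len G e} \<inter> restrict_edge G ?u e -` T
        = {x \<in> {0..len G e}. edge_point G e x \<in> {p \<in> points G. ?u p \<in> T}}"
      using edge_point_in_points[OF G e] by (auto simp: restrict_edge_def)
    ultimately show ?thesis by simp
  qed
  then show "openin (graph_topology G) {p \<in> topspace (graph_topology G). ?u p \<in> T}"
    unfolding topspace_graph_topology[OF G] openin_graph_topology by blast
qed simp

lemma continuous_on_restrict_edge:
  assumes G: "metric_graph G" and e: "e \<in> edges G"
    and u: "continuous_map (graph_topology G) euclideanreal u"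
  shows "continuous_on {0..len G e} (restrict_edge G u e)"
  unfolding continuous_on_open_gen[of _ _ UNIV, simplified]
proof (intro allI impI)
  fix T :: "real set" assume T: "open T"
  have "openin (graph_topology G) {p \<in> points G. u p \<in> T}"
    using openin_continuous_map_preimage[OF u, of T] T topspace_graph_topology[OF G] by simp
  then have "openin (top_of_set {0..len G e})
      {x \<in> {0..len G e}. edge_point G e x \<in> {p \<in> points G. u p \<in> T}}"
    using e unfolding openin_graph_topology by blast
  moreover have "{0..len G e} \<inter> restrict_edge G u e -` T
      = {x \<in> {0..len G e}. edge_point G e x \<in> {p \<in> points G. u p \<in> T}}"
    using edge_point_in_points[OF G e] by (auto simp: restrict_edge_def)
  ultimately show "openin (top_of_set {0..len G e}) ({0..len G e} \<inter> restrict_edge G u e -` T)"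
    by simp
qed

lemma normal_deriv_sum_torsion:
  assumes G: "metric_graph G"
    and u: "\<forall>e\<in>edges G. \<forall>x\<in>{0..len G e}.
      restrict_edge G u e x = edge_torsion (U (tail G e)) (U (head G e)) (len G e) x"
  shows "normal_deriv_sum G u v =
     (\<Sum>e\<in>{e\<in>edges G. head G e = v}. (U (head G e) - U (tail G e)) / len G e - len G e / 2) +
     (\<Sum>e\<in>{e\<in>edges G. tail G e = v}. (U (tail G e) - U (head G e)) / len G e - len G e / 2)"
proof -
  have vd: "vector_derivative (restrict_edge G u e) (at x within {0..len G e}) =
      (U (head G e) - U (tail G e)) / len G e + len G e / 2 - x"
    if e: "e \<in> edges G" and x: "x \<in> {0..len G e}" for e x
  proof (rule vector_derivative_within_closed_interval)
    show "0 < len G e" using G e by (auto simp: metric_graph_def)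
    show "(restrict_edge G u e has_vector_derivative
       (U (head G e) - U (tail G e)) / len G e + len G e / 2 - x) (at x within {0..len G e})"
      using edge_torsion_deriv[OF bspec[OF bspec[OF u e]] x]
      by (simp add: has_real_derivative_iff_has_vector_derivative)
  qed (rule x)
  have pos: "0 < len G e" if "e \<in> edges G" for e using G that by (auto simp: metric_graph_def)
  have nd: "normal_deriv_head G u e = (U (head G e) - U (tail G e)) / len G e - len G e / 2"
    "normal_deriv_tail G u e = (U (tail G e) - U (head G e)) / len G e - len G e / 2"
    if "e \<in> edges G" for e
    using vd[OF that, of "len G e"] vd[OF that, of 0] pos[OF that]
    by (simp_all add: normal_deriv_head_def normal_deriv_tail_def diff_divide_distrib)
  show ?thesis
    unfolding normal_deriv_sum_def
    by (intro arg_cong2[of _ _ _ _ "(+)"] sum.cong refl) (simp_all only: nd mem_Collect_eq)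
qed

lemma minus_laplacian_torsion_extension:
  assumes G: "metric_graph G" and U: "torsion_values G \<alpha> U"
  shows "minus_laplacian G \<alpha> (torsion_extension G U) (\<lambda>_. 1)"
proof -
  note u = restrict_edge_torsion_extension[OF G, of _ _ U]
  have pos: "0 < len G e" if "e \<in> edges G" for e using G that by (auto simp: metric_graph_def)
  have "normal_deriv_sum G (torsion_extension G U) v + \<alpha> v * torsion_extension G U (Vertex v) = 0"
    if "v \<in> verts G" for v
  proof -
    have "\<forall>e\<in>edges G. \<forall>x\<in>{0..len G e}. restrict_edge G (torsion_extension G U) e x =
        edge_torsion (U (tail G e)) (U (head G e)) (len G e) x"
      using u by blast
    from normal_deriv_sum_torsion[OF G this] show ?thesis
      unfolding torsion_extension_Vertex[OF that]
      using bspec[OF U[unfolded torsion_values_iff[OF G]] that] by (simp only:)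
  qed
  moreover have "torsion_extension G U \<in> extensional (points G)"
    by (simp add: torsion_extension_def)
  ultimately show ?thesis
    using edge_torsion_weak[OF pos u] torsion_extension_continuous[OF G]
    by (simp add: minus_laplacian_def laplacian_domain_def restrict_edge_def[of G "\<lambda>_. 1"]
        continuous_in_L2)
qed

text \<open>On each edge, uniqueness for given end values identifies the solution with the
  quadratic. The vertex conditions then read exactly as the discrete system.\<close>

lemma minus_laplacian_imp_torsion:
  assumes G: "metric_graph G" and u: "minus_laplacian G \<alpha> u (\<lambda>_. 1)"
  defines "U \<equiv> \<lambda>v. u (Vertex v)"
  shows "torsion_values G \<alpha> U" and "u = torsion_extension G U"
proof -
  have pos: "0 < len G e" if "e \<in> edges G" for e using G that by (auto simp: metric_graph_def)
  have cont: "continuous_map (graph_topology G) euclideanreal u"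
    and ext: "u \<in> extensional (points G)"
    and vert: "\<And>v. v \<in> verts G \<Longrightarrow> normal_deriv_sum G u v + \<alpha> v * U v = 0"
    and weak: "\<And>e. e \<in> edges G \<Longrightarrow> weak_derivative2 (len G e) (restrict_edge G u e) (\<lambda>_. - 1)"
    using u by (auto simp: minus_laplacian_def laplacian_domain_def restrict_edge_def[of G "\<lambda>_. 1"] U_def)
  have eq: "restrict_edge G u e x = edge_torsion (U (tail G e)) (U (head G e)) (len G e) x"
    if e: "e \<in> edges G" and x: "x \<in> {0..len G e}" for e x
  proof (rule weak_derivative2_unique[OF pos[OF e] continuous_on_restrict_edge[OF G e cont] _
        weak[OF e] _ _ _ x])
    let ?q = "edge_torsion (U (tail G e)) (U (head G e)) (len G e)"
    show "continuous_on {0..len G e} ?q"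
      using edge_torsion_deriv[OF refl] DERIV_continuous_on by blast
    show "weak_derivative2 (len G e) ?q (\<lambda>_. - 1)"
      using edge_torsion_weak(2)[OF pos[OF e] refl] .
    show "restrict_edge G u e 0 = ?q 0" "restrict_edge G u e (len G e) = ?q (len G e)"
      using pos[OF e] by (simp_all add: restrict_edge_def edge_point_def edge_torsion_ends U_def)
  qed
  show "torsion_values G \<alpha> U"
  proof -
    have "\<forall>e\<in>edges G. \<forall>x\<in>{0..len G e}. restrict_edge G u e x =
        edge_torsion (U (tail G e)) (U (head G e)) (len G e) x"
      using eq by blast
    from normal_deriv_sum_torsion[OF G this] show ?thesis
      unfolding torsion_values_iff[OF G] using vert by metis
  qed
  show "u = torsion_extension G U"
  proof (rule extensionalityI[OF ext])
    show "torsion_extension G U \<in> extensional (points G)"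
      by (simp add: torsion_extension_def)
    fix p assume p: "p \<in> points G"
    then consider v where "p = Vertex v" "v \<in> verts G"
      | e x where "p = Interior e x" "e \<in> edges G" "0 < x" "x < len G e"
      by (auto simp: points_def)
    then show "u p = torsion_extension G U p"
    proof cases
      case 1
      then show ?thesis by (simp add: torsion_extension_Vertex U_def)
    next
      case 2
      then have "restrict_edge G u e x = restrict_edge G (torsion_extension G U) e x"
        by (simp add: eq restrict_edge_torsion_extension[OF G])
      then show ?thesis using 2 by (simp add: restrict_edge_def edge_point_def)
    qed
  qed
qed

lemma torsion_function_eq:
  assumes G: "metric_graph G" and def: "energy_definite G \<alpha>" and U: "torsion_values G \<alpha> U"
  shows "torsion_function G \<alpha> = torsion_extension G U"
  unfolding torsion_function_def
proof (rule the_equality)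
  show "minus_laplacian G \<alpha> (torsion_extension G U) (\<lambda>_. 1)"
    by (rule minus_laplacian_torsion_extension[OF G U])
  fix u assume u: "minus_laplacian G \<alpha> u (\<lambda>_. 1)"
  have val: "u (Vertex v) = U v" if "v \<in> verts G" for v
    using torsion_values_unique[OF def minus_laplacian_imp_torsion(1)[OF G u] U that] .
  have "u = torsion_extension G (\<lambda>v. u (Vertex v))"
    by (rule minus_laplacian_imp_torsion(2)[OF G u])
  \<comment> \<open>The two vectors are known to agree only on the vertices, and the extension
    depends on nothing else.\<close>
  also have "\<dots> = torsion_extension G U"
    unfolding torsion_extension_def
    by (rule restrict_ext) (use G val in \<open>auto simp: points_def metric_graph_def\<close>)
  finally show "u = torsion_extension G U" .
qed

text \<open>The cubic term depends on the edge lengths alone, so comparing rigidities reduces to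
  comparing loads.\<close>

lemma torsional_rigidity_eq:
  assumes G: "metric_graph G" and def: "energy_definite G \<alpha>" and U: "torsion_values G \<alpha> U"
  shows "torsional_rigidity G \<alpha> = load G U + (\<Sum>e\<in>edges G. len G e ^ 3 / 12)"
proof -
  have "(LINT x|lebesgue_on {0..len G e}. restrict_edge G (torsion_extension G U) e x) =
      len G e / 2 * (U (head G e) + U (tail G e)) + len G e ^ 3 / 12" if "e \<in> edges G" for e
    by (rule edge_torsion_integral[OF _ restrict_edge_torsion_extension[OF G that]])
       (use G that in \<open>auto simp: metric_graph_def\<close>)
  then show ?thesis
    by (simp add: torsional_rigidity_def graph_integral_def torsion_function_eq[OF assms]
        load_def sum.distrib)
qed

section \<open>Insertion\<close>

text \<open>A vector constant on the inserted vertices does not see which of them an edge end was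
  attached to, so every choice of insertion is treated at once.\<close>

lemma insertion_pullback:
  assumes ins: "is_insertion G v0 G' Gt"
    and W: "\<And>v. v \<in> verts G' \<Longrightarrow> W v = c" and e: "e \<in> edges G"
  shows "W (head Gt e) = (W(v0 := c)) (head G e)" "W (tail Gt e) = (W(v0 := c)) (tail G e)"
  using ins W e by (auto simp: is_insertion_def split: if_splits)

text \<open>Zero energy first forces \<open>W\<close> to vanish on the inserted graph, by its
  connectedness and a nonzero strength. Collapsing that graph back to \<open>v0\<close> then carries
  the value zero through \<open>G\<close>.\<close>

lemma insertion_energy_definite:
  assumes G: "metric_graph G" "connected_graph G" and G': "metric_graph G'" "connected_graph G'"
    and disj: "verts G \<inter> verts G' = {}"
    and \<alpha>': "\<exists>v\<in>verts G'. \<alpha>t v \<noteq> 0" and v0: "v0 \<in> verts G"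
    and Gt: "metric_graph Gt" and ins: "is_insertion G v0 G' Gt"
    and \<alpha>t: "\<forall>v\<in>verts Gt. 0 \<le> \<alpha>t v"
  shows "energy_definite Gt \<alpha>t"
  unfolding energy_definite_def
proof (intro allI impI ballI)
  fix W v assume W: "energy Gt \<alpha>t W W = 0" and v: "v \<in> verts Gt"
  note edge = energy_eq_0D(1)[OF Gt \<alpha>t W] and vert = energy_eq_0D(2)[OF Gt \<alpha>t W]
  have Vt: "verts Gt = verts G - {v0} \<union> verts G'" and Et: "edges Gt = edges G \<union> edges G'"
    using ins disj v0 by (auto simp: is_insertion_def)
  obtain a where a: "a \<in> verts G'" "\<alpha>t a \<noteq> 0" using \<alpha>' by auto
  have W': "W u = 0" if "u \<in> verts G'" for u
  proof -
    have "W u = W a"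
    proof (rule connected_graph_constant[OF G' _ that a(1)])
      fix e assume "e \<in> edges G'"
      then show "W (tail G' e) = W (head G' e)"
        using edge[of e] ins by (auto simp: is_insertion_def)
    qed
    then show ?thesis using vert[of a] a Vt by simp
  qed
  \<comment> \<open>The vector on \<open>G\<close> with value zero at \<open>v0\<close> is constant
    along the edges of \<open>G\<close> because \<open>W\<close> is constant along the reattached
    ones.\<close>
  have "(W(v0 := 0)) u = (W(v0 := 0)) v0" if "u \<in> verts G" for u
  proof (rule connected_graph_constant[OF G _ that v0])
    fix e assume "e \<in> edges G"
    then show "(W(v0 := 0)) (tail G e) = (W(v0 := 0)) (head G e)"
      using edge[of e] Et insertion_pullback[where W = W and c = 0, OF ins W'] by simp
  qed
  from this[of v] show "W v = 0" using v W' unfolding Vt by (cases "v \<in> verts G'") auto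
qed

text \<open>Edges of \<open>G\<close> contribute equally on both sides; the inserted edges add
  nonnegative terms.\<close>

lemma load_insertion_ge:
  assumes Gt: "metric_graph Gt"
    and ins: "is_insertion G v0 G' Gt"
    and W: "\<And>v. v \<in> verts G' \<Longrightarrow> W v = c" "\<And>v. v \<in> verts Gt \<Longrightarrow> 0 \<le> W v"
  shows "load G (W(v0 := c)) \<le> load Gt W"
proof -
  have Et: "edges Gt = edges G \<union> edges G'" and len: "\<And>e. e \<in> edges G \<Longrightarrow> len Gt e = len G e"
    using ins by (auto simp: is_insertion_def)
  have "load G (W(v0 := c)) = (\<Sum>e\<in>edges G. len Gt e / 2 * (W (head Gt e) + W (tail Gt e)))"
    unfolding load_def by (rule sum.cong) (simp_all only: insertion_pullback[where W = W and c = c, OF ins W(1)] len)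
  also have "\<dots> \<le> load Gt W"
    unfolding load_def using Gt W(2) Et
    by (intro sum_mono2) (auto simp: metric_graph_def less_imp_le intro!: mult_nonneg_nonneg add_nonneg_nonneg)
  finally show ?thesis .
qed

text \<open>Inserted edges carry no energy because \<open>W\<close> is constant on them, and the
  strengths on \<open>G'\<close> contribute \<open>c * c\<close> times their sum, which is at most
  the former contribution at \<open>v0\<close>.\<close>

lemma energy_insertion_le:
  assumes G: "metric_graph G" and G': "metric_graph G'"
    and disj: "verts G \<inter> verts G' = {}" "edges G \<inter> edges G' = {}"
    and v0: "v0 \<in> verts G" and ins: "is_insertion G v0 G' Gt"
    and \<alpha>t: "\<forall>v\<in>verts G - {v0}. \<alpha>t v = \<alpha> v" and le: "(\<Sum>v\<in>verts G'. \<alpha>t v) \<le> \<alpha> v0"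
    and W: "\<And>v. v \<in> verts G' \<Longrightarrow> W v = c"
  shows "energy Gt \<alpha>t W W \<le> energy G \<alpha> (W(v0 := c)) (W(v0 := c))"
proof -
  have fin: "finite (verts G)" "finite (verts G')" "finite (edges G)" "finite (edges G')"
    using G G' by (auto simp: metric_graph_def)
  have Vt: "verts Gt = (verts G - {v0}) \<union> verts G'" and Et: "edges Gt = edges G \<union> edges G'"
    and len: "\<And>e. e \<in> edges G \<Longrightarrow> len Gt e = len G e"
    using ins disj v0 by (auto simp: is_insertion_def)
  let ?W = "W(v0 := c)"
  let ?d = "\<lambda>G W e. (W (head G e) - W (tail G e)) * (W (head G e) - W (tail G e)) / len G e"
  have "?d Gt W e = 0" if "e \<in> edges G'" for e
    using that ins G' W by (simp add: is_insertion_def metric_graph_def)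
  then have "(\<Sum>e\<in>edges Gt. ?d Gt W e) = (\<Sum>e\<in>edges G. ?d Gt W e)"
    unfolding Et using fin by (intro sum.mono_neutral_right) auto
  also have "\<dots> = (\<Sum>e\<in>edges G. ?d G ?W e)"
    by (rule sum.cong) (simp_all only: insertion_pullback[where W = W and c = c, OF ins W] len)
  finally have edges: "(\<Sum>e\<in>edges Gt. ?d Gt W e) = (\<Sum>e\<in>edges G. ?d G ?W e)" .
  have "(\<Sum>v\<in>verts Gt. \<alpha>t v * W v * W v) =
      (\<Sum>v\<in>verts G - {v0}. \<alpha>t v * W v * W v) + (\<Sum>v\<in>verts G'. \<alpha>t v * W v * W v)"
    unfolding Vt using fin disj by (intro sum.union_disjoint) auto
  also have "(\<Sum>v\<in>verts G - {v0}. \<alpha>t v * W v * W v) = (\<Sum>v\<in>verts G - {v0}. \<alpha> v * ?W v * ?W v)"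
    by (rule sum.cong) (use \<alpha>t in auto)
  also have "(\<Sum>v\<in>verts G'. \<alpha>t v * W v * W v) = (\<Sum>v\<in>verts G'. \<alpha>t v) * (c * c)"
    by (simp add: W sum_distrib_right mult.assoc)
  also have "\<dots> \<le> \<alpha> v0 * (c * c)"
    by (rule mult_right_mono[OF le]) simp
  also have "(\<Sum>v\<in>verts G - {v0}. \<alpha> v * ?W v * ?W v) + \<alpha> v0 * (c * c) = (\<Sum>v\<in>verts G. \<alpha> v * ?W v * ?W v)"
    using sum.remove[OF fin(1) v0, of "\<lambda>v. \<alpha> v * ?W v * ?W v"] by simp
  finally show ?thesis unfolding energy_def edges by simp
qed

section \<open>Replacing vertex values by their absolute values\<close>

text \<open>Comparing with \<open>\<bar>U\<bar>\<close> instead of \<open>U\<close> makes the positivity of the torsion function unnecessary.\<close>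

lemma load_abs_ge:
  assumes "metric_graph G"
  shows "load G U \<le> load G (\<lambda>v. \<bar>U v\<bar>)"
  unfolding load_def using assms
  by (intro sum_mono mult_left_mono add_mono) (auto simp: metric_graph_def)

text \<open>Squared reverse triangle inequality on each edge; the vertex terms are
  unchanged.\<close>

lemma energy_abs_le:
  assumes "metric_graph G"
  shows "energy G \<alpha> (\<lambda>v. \<bar>U v\<bar>) (\<lambda>v. \<bar>U v\<bar>) \<le> energy G \<alpha> U U"
  unfolding energy_def
proof (rule add_mono)
  show "(\<Sum>e\<in>edges G. (\<bar>U (head G e)\<bar> - \<bar>U (tail G e)\<bar>) * (\<bar>U (head G e)\<bar> - \<bar>U (tail G e)\<bar>) / len G e)
     \<le> (\<Sum>e\<in>edges G. (U (head G e) - U (tail G e)) * (U (head G e) - U (tail G e)) / len G e)"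
  proof (rule sum_mono)
    fix e assume "e \<in> edges G"
    then have "0 < len G e" using assms by (auto simp: metric_graph_def)
    moreover have "(\<bar>a\<bar> - \<bar>b\<bar>) * (\<bar>a\<bar> - \<bar>b\<bar>) \<le> (a - b) * (a - b)" for a b :: real
      using abs_ge_self[of "a * b"] by (simp add: algebra_simps abs_mult)
    ultimately show "(\<bar>U (head G e)\<bar> - \<bar>U (tail G e)\<bar>) * (\<bar>U (head G e)\<bar> - \<bar>U (tail G e)\<bar>) / len G e
        \<le> (U (head G e) - U (tail G e)) * (U (head G e) - U (tail G e)) / len G e"
      by (intro divide_right_mono) auto
  qed
qed (simp add: mult.assoc)

lemma load_cong:
  assumes "metric_graph G" "\<forall>v\<in>verts G. U v = U' v"
  shows "load G U = load G U'"
  using assms unfolding load_def metric_graph_def by (intro sum.cong) auto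

lemma energy_cong:
  assumes "metric_graph G" "\<forall>v\<in>verts G. U v = U' v"
  shows "energy G \<alpha> U U = energy G \<alpha> U' U'"
  using assms unfolding energy_def metric_graph_def
  by (intro arg_cong2[of _ _ _ _ "(+)"] sum.cong) auto

theorem theorem7p7:
  fixes G G' Gt :: "('v, 'e) mgraph"
    and \<alpha> \<alpha>' \<alpha>t :: "'v \<Rightarrow> real"
    and v0 :: 'v
  assumes "metric_graph G" and "connected_graph G"
    and "metric_graph G'" and "connected_graph G'"
    and "verts G \<inter> verts G' = {}" and "edges G \<inter> edges G' = {}"
    and "\<forall>v\<in>verts G. 0 \<le> \<alpha> v" and "\<exists>v\<in>verts G. \<alpha> v \<noteq> 0"
    and "\<forall>v\<in>verts G'. 0 \<le> \<alpha>' v" and "\<exists>v\<in>verts G'. \<alpha>' v \<noteq> 0"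
    and "v0 \<in> verts G"
    and "metric_graph Gt" and "is_insertion G v0 G' Gt"
    and "\<forall>v\<in>verts G - {v0}. \<alpha>t v = \<alpha> v"
    and "\<forall>v\<in>verts G'. \<alpha>t v = \<alpha>' v"
    and "(\<Sum>v\<in>verts G'. \<alpha>' v) \<le> \<alpha> v0"
  shows "torsional_rigidity G \<alpha> \<le> torsional_rigidity Gt \<alpha>t"
proof -
  note G = assms(1,2) and G' = assms(3,4) and disj = assms(5,6) and \<alpha> = assms(7,8)
    and v0 = assms(11) and Gt = assms(12) and ins = assms(13) and \<alpha>t = assms(14,15)
  have Vt: "verts Gt = verts G - {v0} \<union> verts G'" and Et: "edges Gt = edges G \<union> edges G'"
    and len: "\<And>e. e \<in> edges G \<Longrightarrow> len Gt e = len G e"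
    using ins disj v0 by (auto simp: is_insertion_def)
  have \<alpha>t_nonneg: "\<forall>v\<in>verts Gt. 0 \<le> \<alpha>t v"
  proof
    fix v assume "v \<in> verts Gt"
    then show "0 \<le> \<alpha>t v"
      by (cases "v \<in> verts G'") (use assms(9) \<alpha>(1) \<alpha>t Vt in auto)
  qed
  have def: "energy_definite G \<alpha>" by (rule connected_energy_definite[OF G \<alpha>])
  have deft: "energy_definite Gt \<alpha>t"
    using insertion_energy_definite[OF G G' disj(1) _ v0 Gt ins \<alpha>t_nonneg] assms(10) \<alpha>t(2) by auto
  obtain U where U: "torsion_values G \<alpha> U" using torsion_values_exist[OF G(1) def] .
  obtain Ut where Ut: "torsion_values Gt \<alpha>t Ut" using torsion_values_exist[OF Gt deft] .
  define W where "W v = (if v \<in> verts G' then \<bar>U v0\<bar> else \<bar>U v\<bar>)" for v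
  let ?W = "W(v0 := \<bar>U v0\<bar>)"
  have W: "W v = \<bar>U v0\<bar>" if "v \<in> verts G'" for v using that by (simp add: W_def)
  \<comment> \<open>By disjointness of the vertex sets, the collapsed test vector is the absolute
    value of \<open>U\<close> on all of \<open>G\<close>.\<close>
  have WU: "\<forall>v\<in>verts G. ?W v = \<bar>U v\<bar>"
    using disj(1) by (auto simp: W_def)
  have sum_le: "(\<Sum>v\<in>verts G'. \<alpha>t v) \<le> \<alpha> v0" using assms(16) \<alpha>t(2) by simp
  have "load G U \<le> load G ?W"
    unfolding load_cong[OF G(1) WU] by (rule load_abs_ge[OF G(1)])
  also have "\<dots> \<le> load Gt W"
    by (rule load_insertion_ge[OF Gt ins W]) (auto simp: W_def)
  finally have load: "load G U \<le> load Gt W" .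
  have "energy Gt \<alpha>t W W \<le> energy G \<alpha> ?W ?W"
    by (rule energy_insertion_le[OF G(1) G'(1) disj v0 ins \<alpha>t(1) sum_le W])
  also have "\<dots> \<le> energy G \<alpha> U U"
    unfolding energy_cong[OF G(1) WU] by (rule energy_abs_le[OF G(1)])
  also have "\<dots> = load G U" using U by (simp add: torsion_values_def)
  \<comment> \<open>Twice the load is at least \<open>2 * load G U\<close>, while the energy is at
    most \<open>load G U\<close>.\<close>
  finally have "load G U \<le> 2 * load Gt W - energy Gt \<alpha>t W W" using load by simp
  also have "\<dots> \<le> load Gt Ut" by (rule load_minus_energy_maximal[OF Gt \<alpha>t_nonneg Ut])
  finally have "load G U \<le> load Gt Ut" .
  \<comment> \<open>Edges of \<open>G\<close> keep their lengths, and inserted edges only add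
    positive cubes.\<close>
  moreover have "(\<Sum>e\<in>edges G. len G e ^ 3 / 12) \<le> (\<Sum>e\<in>edges Gt. len Gt e ^ 3 / 12)"
  proof -
    have "(\<Sum>e\<in>edges G. len G e ^ 3 / 12) = (\<Sum>e\<in>edges G. len Gt e ^ 3 / 12)"
      by (simp add: len)
    also have "\<dots> \<le> (\<Sum>e\<in>edges Gt. len Gt e ^ 3 / 12)"
      using Gt unfolding Et metric_graph_def
      by (intro sum_mono2) (auto simp: Et intro!: divide_nonneg_pos zero_le_power less_imp_le)
    finally show ?thesis .
  qed
  ultimately show ?thesis
    by (simp add: torsional_rigidity_eq[OF G(1) def U] torsional_rigidity_eq[OF Gt deft Ut])
qed

end
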